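(* Let $\xi_k$, $k\in\mathbb N$, be the sequence of (random) designs generated by the $p$-step-ahead algorithm as described in the context, and assume that the sequence of adaptive estimators $\widehat\theta_k$, $k\in\mathbb N$, employed by the algorithm is strongly consistent, that is, $\widehat\theta_k\to\overline\theta$ almost surely as $k\to\infty$, where $\overline\theta\in\Theta$ is the true parameter point. Then: (i) $\mathrm{dist}\bigl(M(\xi_k,\overline\theta),\,\mathrm{Conv}\,\mathcal M_{\mathrm s*}(\overline\theta)\bigr)\to0$ almost surely as $k\to\infty$, and hence $\liminf_{k\to\infty}\det M(\xi_k,\overline\theta)\ge d_{\mathrm s*}(\overline\theta)$ almost surely. (ii) If the information matrices at $\overline\theta$ of all locally D-optimal saturated designs at $\overline\theta$ coincide, being equal to one matrix $M_{\mathrm s*}(\overline\theta)$, then $M(\xi_k,\overline\theta)\to M_{\mathrm s*}(\overline\theta)$ and $\det M(\xi_k,\overline\theta)\to d_{\mathrm s*}(\overline\theta)$ almost surely as $k\to\infty$. (iii) If there exists a locally D-optimal design at $\overline\theta$ which is saturated, then the designs $\xi_k$ are almost surely asymptotically locally D-optimal at $\overline\theta$, that is, $M(\xi_k,\overline\theta)\to M_*(\overline\theta)$ and $\det M(\xi_k,\overline\theta)\to d_*(\overline\theta)$ almost surely as $k\to\infty$.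
   Context: Setting: $p\in\mathbb N$; $\mathcal X$ (experimental region) and $\Theta$ (parameter space) are compact metric spaces; $f_\theta:\mathcal X\to\mathbb R^p$, $\theta\in\Theta$, is a family of functions such that $(x,\theta)\mapsto f_\theta(x)$ is continuous on $\mathcal X\times\Theta$ and, for each $\theta\in\Theta$, the image $f_\theta(\mathcal X)$ spans $\mathbb R^p$. Designs: A design is a probability measure $\xi$ on $\mathcal X$ with finite support; its information matrix at $\theta$ is $M(\xi,\theta)=\sum_{x\in\mathrm{supp}(\xi)}\xi(x)f_\theta(x)f_\theta^{T}(x)$. A design is locally D-optimal at $\overline\theta$ if it maximizes $\det M(\xi,\overline\theta)$ over all designs $\xi$; $d_*(\overline\theta)$ denotes the maximum value and $M_*(\overline\theta)$ the (unique) information matrix at $\overline\theta$ of the locally D-optimal designs at $\overline\theta$. A design is saturated if its support has exactly $p$ points. A locally D-optimal saturated design at $\overline\theta$ is a saturated design maximizing $\det M(\eta,\overline\theta)$ over all saturated designs $\eta$; $d_{\mathrm s*}(\overline\theta)$ denotes this maximum value, and $\mathcal M_{\mathrm s*}(\overline\theta)=\{M(\eta^*,\overline\theta):\eta^*\text{ is a locally D-optimal saturated design at }\overline\theta\}$. $\mathrm{Conv}$ denotes the convex hull, and $\mathrm{dist}(B,\mathcal A)=\inf_{A\in\mathcal A}\|B-A\|$ with the Frobenius norm $\|\cdot\|$ on $\mathbb R^{p\times p}$. Algorithm: On a probability space there are $\mathcal X$-valued random variables $X_i$, $i\in\mathbb N$ (design points), and $\Theta$-valued random variables $\widehat\theta_k$,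 $k\in\mathbb N$ (the adaptive estimators employed by the algorithm, computed from the design points and observed responses available at stage $k$). Let $n_1\in\mathbb N$ and $n_k=n_1+(k-1)p$; $X_1,\ldots,X_{n_1}$ are arbitrary, and for every $k\ge1$ (pathwise) $$\bigl(\det[f_{\widehat\theta_k}(X_{n_k+1}),\ldots,f_{\widehat\theta_k}(X_{n_k+p})]\bigr)^2=\max_{z_1,\ldots,z_p\in\mathcal X}\bigl(\det[f_{\widehat\theta_k}(z_1),\ldots,f_{\widehat\theta_k}(z_p)]\bigr)^2 .$$ The generated designs are $\xi_k=\frac1{n_k}\sum_{i=1}^{n_k}\delta[X_i]$, where $\delta[x]$ is the one-point distribution at $x$. *)

theory Defs
  imports "HOL-Probability.Probability"
begin

text \<open>
  The dimension p is CARD('p), the experimental region is a set \<open>R\<close> in a metric space, and the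
  family of regression functions is written \<open>f \<theta> x\<close>. The norm of the type
  \<open>real ^ 'p ^ 'p\<close> (an l2-norm of l2-norms) is the Frobenius norm, so that the library's
  \<open>infdist\<close> on this type is the distance from a set in the Frobenius norm.
\<close>

definition design :: "'x set \<Rightarrow> 'x pmf \<Rightarrow> bool" where
  "design R \<xi> \<longleftrightarrow> finite (set_pmf \<xi>) \<and> set_pmf \<xi> \<subseteq> R"

definition info_matrix :: "('t \<Rightarrow> 'x \<Rightarrow> real ^ 'p) \<Rightarrow> 'x pmf \<Rightarrow> 't \<Rightarrow> real ^ 'p ^ 'p" where
  "info_matrix f \<xi> \<theta> =
     (\<Sum>x\<in>set_pmf \<xi>. pmf \<xi> x *\<^sub>R (\<chi> i j. f \<theta> x $ i * f \<theta> x $ j))"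

definition locally_D_optimal ::
    "'x set \<Rightarrow> ('t \<Rightarrow> 'x \<Rightarrow> real ^ 'p) \<Rightarrow> 't \<Rightarrow> 'x pmf \<Rightarrow> bool" where
  "locally_D_optimal R f \<theta> \<xi> \<longleftrightarrow>
     is_arg_max (\<lambda>\<eta>. det (info_matrix f \<eta> \<theta>)) (design R) \<xi>"

definition D_opt_value :: "'x set \<Rightarrow> ('t \<Rightarrow> 'x \<Rightarrow> real ^ 'p) \<Rightarrow> 't \<Rightarrow> real" where
  "D_opt_value R f \<theta> = (GREATEST d. \<exists>\<xi>. design R \<xi> \<and> d = det (info_matrix f \<xi> \<theta>))"

text \<open>Well defined, since all locally D-optimal designs share their information matrix.\<close>

definition D_opt_info :: "'x set \<Rightarrow> ('t \<Rightarrow> 'x \<Rightarrow> real ^ 'p) \<Rightarrow> 't \<Rightarrow> real ^ 'p ^ 'p" where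
  "D_opt_info R f \<theta> = (THE A. \<exists>\<xi>. locally_D_optimal R f \<theta> \<xi> \<and> A = info_matrix f \<xi> \<theta>)"

definition saturated_design :: "nat \<Rightarrow> 'x set \<Rightarrow> 'x pmf \<Rightarrow> bool" where
  "saturated_design p R \<xi> \<longleftrightarrow> design R \<xi> \<and> card (set_pmf \<xi>) = p"

definition locally_D_optimal_saturated ::
    "'x set \<Rightarrow> ('t \<Rightarrow> 'x \<Rightarrow> real ^ 'p) \<Rightarrow> 't \<Rightarrow> 'x pmf \<Rightarrow> bool" where
  "locally_D_optimal_saturated R f \<theta> \<xi> \<longleftrightarrow>
     is_arg_max (\<lambda>\<eta>. det (info_matrix f \<eta> \<theta>)) (saturated_design CARD('p) R) \<xi>"

definition D_opt_sat_value :: "'x set \<Rightarrow> ('t \<Rightarrow> 'x \<Rightarrow> real ^ 'p) \<Rightarrow> 't \<Rightarrow> real" where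
  "D_opt_sat_value R f \<theta> =
     (GREATEST d. \<exists>\<eta>. saturated_design CARD('p) R \<eta> \<and> d = det (info_matrix f \<eta> \<theta>))"

definition D_opt_sat_infos ::
    "'x set \<Rightarrow> ('t \<Rightarrow> 'x \<Rightarrow> real ^ 'p) \<Rightarrow> 't \<Rightarrow> (real ^ 'p ^ 'p) set" where
  "D_opt_sat_infos R f \<theta> =
     {info_matrix f \<eta> \<theta> | \<eta>. locally_D_optimal_saturated R f \<theta> \<eta>}"

text \<open>
  \<open>n\<^sub>k\<close>, for stages k = 1, 2, ...; p is the number of points added in each stage.
\<close>

definition sample_size :: "nat \<Rightarrow> nat \<Rightarrow> nat \<Rightarrow> nat" where
  "sample_size n\<^sub>1 p k = n\<^sub>1 + (k - 1) * p"

text \<open>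
  The average of the one-point distributions at \<open>x 1, \<dots>, x n\<close> (with repetitions), as the
  image of the uniform distribution on the indices.
\<close>

definition empirical_design :: "(nat \<Rightarrow> 'x) \<Rightarrow> nat \<Rightarrow> 'x pmf" where
  "empirical_design x n = map_pmf x (pmf_of_set {1..n})"

definition column_matrix ::
    "('t \<Rightarrow> 'x \<Rightarrow> real ^ 'p) \<Rightarrow> 't \<Rightarrow> ('p \<Rightarrow> 'x) \<Rightarrow> real ^ 'p ^ 'p" where
  "column_matrix f \<theta> z = (\<chi> i j. f \<theta> (z j) $ i)"

text \<open>
  The step rule: the next p points \<open>x (n + 1), \<dots>, x (n + p)\<close> after the first n maximize the
  squared determinant. \<open>to_nat_on UNIV\<close> is a bijection from the index type onto
  \<open>{..<CARD('p)}\<close>; the squared determinant does not depend on this enumeration of the columns.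
\<close>

definition p_step_ahead ::
    "'x set \<Rightarrow> ('t \<Rightarrow> 'x \<Rightarrow> real ^ 'p) \<Rightarrow> 't \<Rightarrow> (nat \<Rightarrow> 'x) \<Rightarrow> nat \<Rightarrow> bool" where
  "p_step_ahead R f \<theta> x n \<longleftrightarrow>
     is_arg_max (\<lambda>z. (det (column_matrix f \<theta> z))\<^sup>2) (\<lambda>z. range z \<subseteq> R)
       (\<lambda>j :: 'p. x (n + 1 + to_nat_on UNIV j))"

end

theory Submission
  imports Defs
begin

text \<open>
  Along almost every path the estimates converge to \<open>\<theta>bar\<close>. Each block of p points added by the
  algorithm maximizes the squared determinant at the current estimate, so by compactness and joint
  continuity the blocks approach the set of maximizers at \<open>\<theta>bar\<close>
  (\<open>infdist_argmax_tendsto_0\<close>). By the inequality of arithmetic and geometric means, the uniform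
  designs on the maximizing tuples at \<open>\<theta>bar\<close> are exactly the locally D-optimal saturated designs
  (\<open>saturated_optimum\<close>). Hence the distance of the information matrix of a block from
  \<open>D_opt_sat_infos R f \<theta>bar\<close> tends to 0. The information matrix of \<open>\<xi> k\<close> is a weighted mean
  of those of the initial design and of the blocks; the distance from a convex set is a convex
  function, so the distance from the convex hull is at most a weighted mean of distances, and it
  tends to 0 as the total weight grows (\<open>infdist_weighted_mean_tendsto_0\<close>).

  The statements on determinants rest on strict quasiconcavity of the determinant on positive
  definite matrices (\<open>det_strict_quasiconcave\<close>). It makes every matrix in the convex hull have a
  determinant of at least \<open>D_opt_sat_value R f \<theta>bar\<close>, which together with compactness of the hull
  bounds the limes inferior, and it makes the information matrix of a locally D-optimal design
  unique (\<open>D_optimal_info_unique\<close>). If all optimal saturated designs share their information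
  matrix, then the hull is a single point. This includes the case of a D-optimal design that is
  saturated: every optimal saturated design is then D-optimal.

  Quasiconcavity is obtained from one extremal problem: to maximize \<open>(det L)\<^sup>2\<close> subject to
  \<open>trace (L ** Q ** transpose L) \<le> CARD('n)\<close> for a positive definite \<open>Q\<close>. A maximizer
  satisfies \<open>L ** Q ** transpose L = mat 1\<close> (\<open>row_form_sum_maximizer_orthonormal\<close>). This yields
  a factorization of \<open>Q\<close> and the bound on a determinant by a trace, with its case of equality;
  diagonal matrices give the inequality of arithmetic and geometric means.
\<close>

section \<open>Positive definite matrices and the determinant\<close>

text \<open>
  Symmetric positive definite matrices; symmetry is part of the notion.
\<close>

definition pos_def :: "real ^ 'n ^ 'n \<Rightarrow> bool" where
  "pos_def A \<longleftrightarrow> transpose A = A \<and> (\<forall>x. x \<noteq> 0 \<longrightarrow> 0 < x \<bullet> (A *v x))"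

text \<open>
  The sum of the quadratic form of \<open>Q\<close> over the rows of \<open>L\<close>, which is the trace of
  \<open>L ** Q ** transpose L\<close>.
\<close>

definition row_form_sum :: "real ^ 'n ^ 'n \<Rightarrow> real ^ 'n ^ 'n \<Rightarrow> real" where
  "row_form_sum Q L = (\<Sum>i\<in>UNIV. L $ i \<bullet> (Q *v L $ i))"

text \<open>
  The entries of \<open>L ** Q ** transpose L\<close> are the values of the bilinear form of \<open>Q\<close> at
  pairs of rows of \<open>L\<close>.
\<close>

lemma congruence_entry:
  fixes Q L :: "real ^ 'n ^ 'n"
  shows "(L ** Q ** transpose L) $ i $ j = L $ i \<bullet> (Q *v L $ j)"
proof -
  have "(L ** Q ** transpose L) $ i $ j = (L ** (Q ** transpose L)) $ i $ j"
    by (simp add: matrix_mul_assoc)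
  also have "\<dots> = L $ i \<bullet> (Q *v L $ j)"
    by (simp add: matrix_matrix_mult_def matrix_vector_mult_def inner_vec_def transpose_def)
  finally show ?thesis .
qed

lemma row_form_sum_eq_trace: "row_form_sum Q L = trace (L ** Q ** transpose L)"
  by (simp add: row_form_sum_def trace_def congruence_entry)

lemma pos_def_imp_inner_sym:
  assumes "pos_def Q"
  shows "x \<bullet> (Q *v y) = y \<bullet> (Q *v x)"
  using assms unfolding pos_def_def
  by (metis dot_lmul_matrix inner_commute transpose_matrix_vector)

lemma pos_def_imp_ge_norm:
  fixes Q :: "real ^ 'n ^ 'n"
  assumes "pos_def Q"
  obtains c where "c > 0" "\<And>x. c * (norm x)\<^sup>2 \<le> x \<bullet> (Q *v x)"
proof -
  have cont: "continuous_on S (\<lambda>x. x \<bullet> (Q *v x))" for S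
    by (intro continuous_intros matrix_vector_mult_linear_continuous_on)
  have "sphere (0::real^'n) 1 \<noteq> {}" by simp
  then obtain x0 where x0: "x0 \<in> sphere 0 1"
    and min: "\<And>y. y \<in> sphere 0 1 \<Longrightarrow> x0 \<bullet> (Q *v x0) \<le> y \<bullet> (Q *v y)"
    using continuous_attains_inf[OF compact_sphere _ cont] by (metis (no_types, lifting))
  let ?c = "x0 \<bullet> (Q *v x0)"
  have "?c * (norm x)\<^sup>2 \<le> x \<bullet> (Q *v x)" for x
  proof (cases "x = 0")
    case False
    let ?y = "(1 / norm x) *\<^sub>R x"
    have "?c \<le> ?y \<bullet> (Q *v ?y)"
      using False by (intro min) simp
    also have "\<dots> = (x \<bullet> (Q *v x)) / (norm x)\<^sup>2"
      by (simp add: matrix_vector_mult_scaleR power2_eq_square)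
    finally show ?thesis
      using False by (simp add: field_simps)
  qed simp
  moreover have "?c > 0"
    using assms x0 unfolding pos_def_def by (metis dist_0_norm mem_sphere norm_zero zero_neq_one)
  ultimately show thesis using that by blast
qed

lemma continuous_on_det:
  fixes F :: "'a::topological_space \<Rightarrow> real ^ 'n ^ 'n"
  assumes "continuous_on S F"
  shows "continuous_on S (\<lambda>x. det (F x))"
  unfolding det_def by (intro continuous_intros assms)

lemma row_form_sum_replace_row:
  fixes Q L :: "real ^ 'n ^ 'n"
  shows "row_form_sum Q (\<chi> k. if k = i then a else L $ k) =
    row_form_sum Q L - L $ i \<bullet> (Q *v L $ i) + a \<bullet> (Q *v a)"
  by (simp add: row_form_sum_def sum.remove[of UNIV i] if_distrib cong: if_cong)

lemma row_form_sum_maximizer_exists: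
  fixes Q :: "real ^ 'n ^ 'n"
  assumes "pos_def Q"
  obtains L :: "real ^ 'n ^ 'n" where "row_form_sum Q L \<le> CARD('n)" "det L \<noteq> 0"
    "\<And>L'. row_form_sum Q L' \<le> CARD('n) \<Longrightarrow> (det L')\<^sup>2 \<le> (det L)\<^sup>2"
proof -
  let ?S = "{L :: real ^ 'n ^ 'n. row_form_sum Q L \<le> CARD('n)}"
  obtain c where c: "c > 0" "\<And>x. c * (norm x)\<^sup>2 \<le> x \<bullet> (Q *v x)"
    using pos_def_imp_ge_norm[OF assms] by blast
  have "continuous_on UNIV (row_form_sum Q)"
    unfolding row_form_sum_def
    by (intro continuous_intros) (auto simp: matrix_vector_mult_def intro!: continuous_intros)
  then have "closed ?S"
    using continuous_closed_vimage closed_Collect_le continuous_on_const by blast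
  moreover have "norm L \<le> sqrt (CARD('n) / c)" if "L \<in> ?S" for L
  proof -
    have "c * (norm L)\<^sup>2 = (\<Sum>i\<in>UNIV. c * (norm (L $ i))\<^sup>2)"
      by (simp add: norm_vec_def L2_set_def sum_nonneg sum_distrib_left)
    also have "\<dots> \<le> row_form_sum Q L"
      unfolding row_form_sum_def by (intro sum_mono c)
    finally have "c * (norm L)\<^sup>2 \<le> CARD('n)"
      using that by simp
    then show ?thesis
      using c(1) by (intro real_le_rsqrt) (simp add: field_simps)
  qed
  then have "bounded ?S" by (rule boundedI)
  ultimately have "compact ?S"
    by (simp add: compact_eq_bounded_closed)
  moreover have "0 \<in> ?S" by (simp add: row_form_sum_def)
  moreover have "continuous_on ?S (\<lambda>L. (det L)\<^sup>2)"
    by (intro continuous_intros continuous_on_det)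
  ultimately obtain L where L: "L \<in> ?S" "\<And>L'. L' \<in> ?S \<Longrightarrow> (det L')\<^sup>2 \<le> (det L)\<^sup>2"
    using continuous_attains_sup[of ?S "\<lambda>L. (det L)\<^sup>2"] by (metis (no_types, lifting) empty_iff)
  define t where "t = row_form_sum Q (mat 1)"
  have row: "(mat 1 :: real^'n^'n) $ i \<noteq> 0" for i
    by (auto simp: mat_def vec_eq_iff)
  have tpos: "t > 0"
    unfolding t_def row_form_sum_def using assms row by (intro sum_pos) (auto simp: pos_def_def)
  define a where "a = sqrt (CARD('n) / t)"
  have a: "a > 0" "a\<^sup>2 = CARD('n) / t"
    using tpos by (auto simp: a_def)
  define E :: "real^'n^'n" where "E = (\<chi> i. a *s (mat 1 :: real^'n^'n) $ i)"
  have "row_form_sum Q E = a\<^sup>2 * t"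
    by (simp add: E_def t_def row_form_sum_def sum_distrib_left scalar_mult_eq_scaleR
        matrix_vector_mult_scaleR power2_eq_square mult_ac)
  then have "E \<in> ?S" using a tpos by simp
  moreover have "det E \<noteq> 0"
    using a by (simp add: E_def det_rows_mul)
  ultimately have "det L \<noteq> 0"
    using L(2)[of E] by (auto simp: le_less)
  then show thesis using that L by auto
qed

text \<open>
  A matrix of largest squared determinant, among those whose rows have a sum of quadratic forms of
  at most \<open>CARD('n)\<close>, has rows that are orthonormal for \<open>Q\<close>. For otherwise the sum can be
  made strictly smaller at the same determinant: if two rows are not orthogonal, by subtracting
  from one its projection onto the other; if they are orthogonal but of different length, by
  multiplying one and dividing the other by the same number. Rescaling all rows then increases the
  determinant.
\<close>

lemma row_form_sum_maximizer_orthonormal: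
  fixes Q L :: "real ^ 'n ^ 'n"
  assumes Q: "pos_def Q"
    and le: "row_form_sum Q L \<le> CARD('n)" and nz: "det L \<noteq> 0"
    and max: "\<And>L'. row_form_sum Q L' \<le> CARD('n) \<Longrightarrow> (det L')\<^sup>2 \<le> (det L)\<^sup>2"
  shows "L ** Q ** transpose L = mat 1"
proof -
  define q where "q i = L $ i \<bullet> (Q *v L $ i)" for i
  have row_nz: "L $ i \<noteq> 0" for i
    using nz det_zero_row(2)[of i L] by (auto simp: row_def vec_eq_iff)
  have q_pos: "q i > 0" for i
    using Q row_nz by (simp add: q_def pos_def_def)
  \<comment> \<open>A matrix with the same determinant and smaller sum could be scaled up.\<close>
  have ge: "CARD('n) \<le> row_form_sum Q L'" if det: "(det L')\<^sup>2 = (det L)\<^sup>2" for L'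
  proof (rule ccontr)
    assume less: "\<not> CARD('n) \<le> row_form_sum Q L'"
    have "L' $ i \<noteq> 0" for i
    proof
      assume "L' $ i = 0"
      then have "det L' = 0" by (intro det_zero_row(2)[of i]) (simp add: row_def vec_eq_iff)
      then show False using nz det by simp
    qed
    then have pos: "row_form_sum Q L' > 0"
      unfolding row_form_sum_def using Q by (intro sum_pos) (auto simp: pos_def_def)
    define s where "s = sqrt (CARD('n) / row_form_sum Q L')"
    have s: "s\<^sup>2 = CARD('n) / row_form_sum Q L'"
      using pos by (simp add: s_def)
    have "s\<^sup>2 > 1" using s pos less by simp
    let ?E = "\<chi> i. s *s L' $ i"
    have "row_form_sum Q ?E = s\<^sup>2 * row_form_sum Q L'"
      by (simp add: row_form_sum_def sum_distrib_left scalar_mult_eq_scaleR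
          matrix_vector_mult_scaleR power2_eq_square mult_ac)
    then have "row_form_sum Q ?E \<le> CARD('n)" using s pos by simp
    then have "(det ?E)\<^sup>2 \<le> (det L)\<^sup>2" by (rule max)
    moreover have "det ?E = s ^ CARD('n) * det L'"
      by (simp add: det_rows_mul)
    then have "(det ?E)\<^sup>2 = (s\<^sup>2) ^ CARD('n) * (det L')\<^sup>2"
      by (simp add: power_mult_distrib power2_eq_square)
    moreover have "(s\<^sup>2) ^ CARD('n) > 1"
      using one_less_power[OF \<open>s\<^sup>2 > 1\<close>, of "CARD('n)"] by simp
    ultimately show False using nz det by (simp add: mult_le_cancel_right2)
  qed
  have tot: "row_form_sum Q L = CARD('n)" using le ge[of L] by simp
  have orth: "L $ i \<bullet> (Q *v L $ j) = 0" if "i \<noteq> j" for i j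
  proof -
    define b where "b = L $ i \<bullet> (Q *v L $ j)"
    \<comment> \<open>The minimizer of the quadratic form along the line through row i in the direction of row j.\<close>
    define t where "t = - b / q j"
    let ?a = "L $ i + t *s L $ j"
    let ?E = "\<chi> k. if k = i then ?a else L $ k"
    have row: "row k L = L $ k" for k by (simp add: row_def)
    have "det ?E = det L"
      using det_row_operation[OF that, of L t] unfolding row .
    then have "CARD('n) \<le> row_form_sum Q ?E" by (intro ge) simp
    moreover have "row_form_sum Q ?E = CARD('n) - q i + ?a \<bullet> (Q *v ?a)"
      by (simp add: row_form_sum_replace_row tot q_def)
    moreover have "?a \<bullet> (Q *v ?a) = q i + 2 * t * b + t\<^sup>2 * q j"
      using pos_def_imp_inner_sym[OF Q, of "L $ j" "L $ i"]
      by (simp add: scalar_mult_eq_scaleR matrix_vector_right_distrib matrix_vector_mult_scaleR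
          inner_add_left inner_add_right q_def b_def power2_eq_square algebra_simps)
    moreover have "2 * t * b + t\<^sup>2 * q j = - (b\<^sup>2 / q j)"
      using q_pos[of j] by (simp add: t_def power2_eq_square field_simps)
    ultimately have "b\<^sup>2 / q j \<le> 0" by linarith
    then show ?thesis using q_pos[of j] by (simp add: b_def divide_le_0_iff)
  qed
  have eq: "q i = q j" if "i \<noteq> j" for i j
  proof -
    \<comment> \<open>Makes the rescaled rows i and j equally long; the sum of their forms drops to twice the
      geometric mean.\<close>
    define s where "s = sqrt (sqrt (q j / q i))"
    have s: "s > 0" "s\<^sup>2 = sqrt (q j) / sqrt (q i)"
      using q_pos[of i] q_pos[of j] by (auto simp: s_def real_sqrt_divide power_divide)
    define d where "d k = (if k = i then s else if k = j then 1 / s else 1)" for k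
    have UN: "UNIV = insert i (insert j (UNIV - {i, j}))" by auto
    have "prod d UNIV = 1"
      using s(1) that by (subst UN) (simp add: d_def)
    then have "det (\<chi> k. d k *s L $ k) = det L"
      by (simp add: det_rows_mul vec_lambda_eta)
    then have "CARD('n) \<le> row_form_sum Q (\<chi> k. d k *s L $ k)" by (intro ge) simp
    also have "\<dots> = (\<Sum>k\<in>UNIV. (d k)\<^sup>2 * q k)"
      by (simp add: row_form_sum_def q_def scalar_mult_eq_scaleR matrix_vector_mult_scaleR
          power2_eq_square mult_ac)
    also have "\<dots> = (s\<^sup>2 * q i + q j / s\<^sup>2) + (\<Sum>k\<in>UNIV - {i, j}. q k)"
      using that by (subst UN) (simp add: d_def power_divide)
    finally have "CARD('n) \<le> (s\<^sup>2 * q i + q j / s\<^sup>2) + (\<Sum>k\<in>UNIV - {i, j}. q k)" .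
    moreover have "CARD('n) = q i + q j + (\<Sum>k\<in>UNIV - {i, j}. q k)"
      using that unfolding tot[symmetric] row_form_sum_def q_def[symmetric] by (subst UN) simp
    moreover have "s\<^sup>2 * q i = sqrt (q i) * sqrt (q j)" "q j / s\<^sup>2 = sqrt (q i) * sqrt (q j)"
      using q_pos[of i] q_pos[of j] by (simp_all add: s(2) field_simps)
    ultimately have "(sqrt (q i) - sqrt (q j))\<^sup>2 \<le> 0"
      using q_pos[of i] q_pos[of j] by (simp add: power2_diff)
    then show ?thesis by simp
  qed
  have "q i = 1" for i
  proof -
    have "real CARD('n) = (\<Sum>k\<in>(UNIV::'n set). q i)"
      unfolding tot[symmetric] row_form_sum_def q_def[symmetric] by (intro sum.cong) (use eq in metis)+
    then show ?thesis by simp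
  qed
  then show ?thesis
    using orth by (simp add: vec_eq_iff congruence_entry mat_def q_def)
qed

lemma pos_def_whitening:
  fixes Q :: "real ^ 'n ^ 'n"
  assumes "pos_def Q"
  obtains L :: "real ^ 'n ^ 'n" where "L ** Q ** transpose L = mat 1" "(det L)\<^sup>2 * det Q = 1"
    "\<And>L'. row_form_sum Q L' \<le> CARD('n) \<Longrightarrow> (det L')\<^sup>2 \<le> (det L)\<^sup>2"
proof -
  obtain L :: "real ^ 'n ^ 'n" where L: "row_form_sum Q L \<le> CARD('n)" "det L \<noteq> 0"
    "\<And>L'. row_form_sum Q L' \<le> CARD('n) \<Longrightarrow> (det L')\<^sup>2 \<le> (det L)\<^sup>2"
    using row_form_sum_maximizer_exists[OF assms] by blast
  have id: "L ** Q ** transpose L = mat 1"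
    by (rule row_form_sum_maximizer_orthonormal[OF assms L])
  then have "det (L ** Q ** transpose L) = 1" by simp
  then have "(det L)\<^sup>2 * det Q = 1"
    by (simp add: det_mul power2_eq_square mult_ac)
  then show thesis using that id L(3) by blast
qed

lemma pos_def_imp_det_pos: "pos_def (Q :: real ^ 'a ^ 'a) \<Longrightarrow> 0 < det Q"
proof -
  assume "pos_def Q"
  then obtain L :: "real ^ 'a ^ 'a" where L: "(det L)\<^sup>2 * det Q = 1"
    by (rule pos_def_whitening)
  have "\<not> det Q \<le> 0"
    using L mult_nonneg_nonpos[of "(det L)\<^sup>2" "det Q"] by auto
  then show ?thesis by simp
qed

text \<open>
  Hadamard's inequality and the inequality of arithmetic and geometric means in one: for a positive
  semidefinite matrix written as \<open>L ** Q ** transpose L\<close>, the determinant is at most 1 if the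
  trace is at most the dimension. The lemma \<open>det_sq_mult_det_eq_1\<close> is the case of equality.
\<close>

lemma det_sq_mult_det_le_1:
  fixes Q L :: "real ^ 'n ^ 'n"
  assumes Q: "pos_def Q" and le: "row_form_sum Q L \<le> CARD('n)"
  shows "(det L)\<^sup>2 * det Q \<le> 1"
proof -
  obtain L0 :: "real ^ 'n ^ 'n" where L0: "(det L0)\<^sup>2 * det Q = 1" "(det L)\<^sup>2 \<le> (det L0)\<^sup>2"
    using pos_def_whitening[OF Q] le by metis
  then show ?thesis
    using pos_def_imp_det_pos[OF Q] mult_right_mono[OF L0(2), of "det Q"] by simp
qed

lemma det_sq_mult_det_eq_1:
  fixes Q L :: "real ^ 'n ^ 'n"
  assumes Q: "pos_def Q" and le: "row_form_sum Q L \<le> CARD('n)" and eq: "(det L)\<^sup>2 * det Q = 1"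
  shows "L ** Q ** transpose L = mat 1"
proof (rule row_form_sum_maximizer_orthonormal[OF Q le])
  show "det L \<noteq> 0" using eq by auto
  show "(det L')\<^sup>2 \<le> (det L)\<^sup>2" if "row_form_sum Q L' \<le> CARD('n)" for L'
    using det_sq_mult_det_le_1[OF Q that] eq pos_def_imp_det_pos[OF Q]
      mult_le_cancel_right_pos[of "det Q" "(det L')\<^sup>2" "(det L)\<^sup>2"] by linarith
qed

lemma pos_def_factor:
  fixes A :: "real ^ 'n ^ 'n"
  assumes "pos_def A"
  obtains C :: "real ^ 'n ^ 'n" where "A = transpose C ** C"
proof -
  obtain L :: "real ^ 'n ^ 'n" where L: "L ** A ** transpose L = mat 1" "(det L)\<^sup>2 * det A = 1"
    using pos_def_whitening[OF assms] by metis
  from L(2) have "invertible L" by (auto simp: invertible_det_nz)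
  then obtain K where K: "K ** L = mat 1" unfolding invertible_def by blast
  have K': "transpose L ** transpose K = mat 1"
    using K by (metis matrix_transpose_mul transpose_mat)
  have "A = (K ** L) ** A ** (transpose L ** transpose K)"
    by (simp add: K K')
  also have "\<dots> = K ** (L ** A ** transpose L) ** transpose K"
    by (simp only: matrix_mul_assoc)
  also have "\<dots> = transpose (transpose K) ** transpose K"
    by (simp add: L(1) transpose_transpose)
  finally show thesis by (rule that)
qed

lemma pos_def_inverse:
  fixes M :: "real ^ 'n ^ 'n"
  assumes M: "pos_def M"
  obtains Q where "pos_def Q" "M ** Q = mat 1" "Q ** M = mat 1"
proof -
  have "invertible M"
    using pos_def_imp_det_pos[OF M] by (simp add: invertible_det_nz)
  then obtain Q where Q: "M ** Q = mat 1" "Q ** M = mat 1"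
    unfolding invertible_def by blast
  have sym: "transpose M = M" using M by (simp add: pos_def_def)
  have "transpose Q = transpose Q ** (M ** Q)" by (simp add: Q)
  also have "\<dots> = transpose (M ** Q) ** Q"
    by (simp add: matrix_transpose_mul sym matrix_mul_assoc)
  also have "\<dots> = Q" by (simp add: Q transpose_mat)
  finally have "transpose Q = Q" .
  moreover have "0 < x \<bullet> (Q *v x)" if "x \<noteq> 0" for x
  proof -
    have x: "M *v (Q *v x) = x" by (simp add: matrix_vector_mul_assoc Q)
    then have "Q *v x \<noteq> 0" using that by auto
    then have "0 < (Q *v x) \<bullet> (M *v (Q *v x))" using M unfolding pos_def_def by blast
    then show ?thesis by (simp add: x inner_commute)
  qed
  ultimately show thesis using that Q unfolding pos_def_def by blast
qed

text \<open>
  Here \<open>Q\<close> is the inverse of \<open>M\<close>. The matrix \<open>A ** Q\<close> has the trace of the positive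
  definite matrix \<open>C ** Q ** transpose C\<close>, where \<open>A = transpose C ** C\<close>, and also its
  determinant.
\<close>

lemma det_le_of_trace_le:
  fixes A M Q :: "real ^ 'n ^ 'n"
  assumes A: "pos_def A" and Q: "pos_def Q" and inv: "M ** Q = mat 1" "Q ** M = mat 1"
    and tr: "trace (A ** Q) \<le> CARD('n)"
  shows "det A \<le> det M" and "det A = det M \<Longrightarrow> A = M"
proof -
  obtain C :: "real ^ 'n ^ 'n" where C: "A = transpose C ** C"
    by (rule pos_def_factor[OF A])
  have "trace (C ** Q ** transpose C) = trace (A ** Q)"
    unfolding C using trace_mul_sym[of "C ** Q" "transpose C"] by (simp add: matrix_mul_assoc)
  then have le: "row_form_sum Q C \<le> CARD('n)" using tr by (simp add: row_form_sum_eq_trace)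
  have detA: "det A = (det C)\<^sup>2" by (simp add: C det_mul power2_eq_square)
  have "det M * det Q = 1" using inv by (metis det_mul det_I)
  then have detM: "det M = 1 / det Q" and "det Q > 0"
    using pos_def_imp_det_pos[OF Q] by (simp_all add: field_simps)
  then show "det A \<le> det M"
    using det_sq_mult_det_le_1[OF Q le] by (simp add: detA detM field_simps)
  assume "det A = det M"
  then have "(det C)\<^sup>2 * det Q = 1"
    using \<open>det Q > 0\<close> by (simp add: detA detM)
  then have "(C ** Q) ** transpose C = mat 1" by (rule det_sq_mult_det_eq_1[OF Q le])
  then have "transpose C ** (C ** Q) = mat 1" by (simp add: matrix_left_right_inverse)
  then have "A ** Q = mat 1" by (simp add: C matrix_mul_assoc)
  then show "A = M" by (metis inv(2) matrix_mul_assoc matrix_mul_lid matrix_mul_rid)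
qed

lemma pos_def_convex_combination:
  assumes "pos_def A" "pos_def B" "0 \<le> u" "0 \<le> v" "u + v = 1"
  shows "pos_def (u *\<^sub>R A + v *\<^sub>R B)"
proof -
  have "0 < x \<bullet> ((u *\<^sub>R A + v *\<^sub>R B) *v x)" if "x \<noteq> 0" for x
  proof -
    have "x \<bullet> ((u *\<^sub>R A + v *\<^sub>R B) *v x) = u * (x \<bullet> (A *v x)) + v * (x \<bullet> (B *v x))"
      by (simp add: matrix_vector_mult_add_rdistrib scaleR_matrix_vector_assoc[symmetric] inner_add_right)
    moreover have "0 < x \<bullet> (A *v x)" "0 < x \<bullet> (B *v x)"
      using assms that by (auto simp: pos_def_def)
    moreover have "0 < u \<or> 0 < v" using assms(3-5) by linarith
    ultimately show ?thesis using assms(3,4)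
      by (smt (verit) mult_nonneg_nonneg mult_pos_pos)
  qed
  moreover have "transpose (u *\<^sub>R A + v *\<^sub>R B) = u *\<^sub>R transpose A + v *\<^sub>R transpose B"
    by (simp add: transpose_def vec_eq_iff)
  then have "transpose (u *\<^sub>R A + v *\<^sub>R B) = u *\<^sub>R A + v *\<^sub>R B"
    using assms(1,2) by (simp add: pos_def_def)
  ultimately show ?thesis by (simp add: pos_def_def)
qed

text \<open>
  With \<open>Q\<close> the inverse of the convex combination \<open>M\<close>, the weighted mean of the traces of
  \<open>A ** Q\<close> and \<open>B ** Q\<close> is the trace of the identity matrix, so that one of them is at most
  \<open>CARD('n)\<close>.
\<close>

lemma det_strict_quasiconcave:
  fixes A B :: "real ^ 'n ^ 'n"
  assumes A: "pos_def A" and B: "pos_def B" and "A \<noteq> B"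
    and uv: "0 < u" "0 < v" "u + v = 1"
  shows "min (det A) (det B) < det (u *\<^sub>R A + v *\<^sub>R B)"
proof -
  define M where "M = u *\<^sub>R A + v *\<^sub>R B"
  have "pos_def M"
    unfolding M_def using assms by (intro pos_def_convex_combination) auto
  then obtain Q where Q: "pos_def Q" "M ** Q = mat 1" "Q ** M = mat 1"
    by (rule pos_def_inverse)
  have "u * trace (A ** Q) + v * trace (B ** Q) = trace (M ** Q)"
    by (simp add: M_def trace_def matrix_matrix_mult_def sum_distrib_left sum.distrib algebra_simps)
  also have "\<dots> = CARD('n)" by (simp add: Q trace_I)
  finally have mean: "u * trace (A ** Q) + v * trace (B ** Q) = CARD('n)" .
  have "trace (A ** Q) \<le> CARD('n) \<or> trace (B ** Q) \<le> CARD('n)"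
  proof (rule ccontr)
    assume "\<not> ?thesis"
    then have "u * CARD('n) + v * CARD('n) < u * trace (A ** Q) + v * trace (B ** Q)"
      using uv by (intro add_strict_mono mult_strict_left_mono) auto
    then show False using mean uv by (simp flip: distrib_right)
  qed
  moreover have "A \<noteq> M" "B \<noteq> M"
  proof -
    have "M - A = v *\<^sub>R (B - A)" "M - B = u *\<^sub>R (A - B)"
      using uv(3) by (simp_all add: M_def algebra_simps eq_diff_eq flip: scaleR_left_distrib)
    then show "A \<noteq> M" "B \<noteq> M" using uv \<open>A \<noteq> B\<close> by auto
  qed
  ultimately have "det A < det M \<or> det B < det M"
    using det_le_of_trace_le[OF A Q] det_le_of_trace_le[OF B Q]
    by (meson order_le_imp_less_or_eq)
  then show ?thesis by (simp add: M_def min_less_iff_disj)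
qed

lemma convex_pos_def_det_ge: "convex {A :: real ^ 'n ^ 'n. pos_def A \<and> d \<le> det A}"
proof (rule convexI, clarsimp, intro conjI)
  fix A B :: "real ^ 'n ^ 'n" and u v :: real
  assume *: "pos_def A" "d \<le> det A" "pos_def B" "d \<le> det B" "0 \<le> u" "0 \<le> v" "u + v = 1"
  show "pos_def (u *\<^sub>R A + v *\<^sub>R B)" using * by (intro pos_def_convex_combination) auto
  show "d \<le> det (u *\<^sub>R A + v *\<^sub>R B)"
  proof (cases "A = B \<or> u = 0 \<or> v = 0")
    case True
    moreover have "u *\<^sub>R A + v *\<^sub>R A = A" using *(7) by (simp flip: scaleR_left_distrib)
    ultimately show ?thesis using * by (elim disjE) simp_all
  next
    case False
    then have "min (det A) (det B) < det (u *\<^sub>R A + v *\<^sub>R B)"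
      using * by (intro det_strict_quasiconcave) auto
    then show ?thesis using *(2,4) by simp
  qed
qed

section \<open>Distances from convex sets and sets of maximizers\<close>

lemma convex_on_infdist:
  fixes A :: "'a::real_normed_vector set"
  assumes "convex A" "A \<noteq> {}"
  shows "convex_on UNIV (\<lambda>x. infdist x A)"
  unfolding convex_on_def
proof (intro conjI strip)
  fix x y :: 'a and u v :: real
  assume uv: "0 \<le> u" "0 \<le> v" "u + v = 1"
  show "infdist (u *\<^sub>R x + v *\<^sub>R y) A \<le> u * infdist x A + v * infdist y A"
  proof (rule field_le_epsilon)
    fix e :: real
    assume "0 < e"
    have near: "\<exists>a\<in>A. dist z a < infdist z A + e" for z
      using assms(2) \<open>0 < e\<close> cInf_lessD[of "dist z ` A" "infdist z A + e"]
      by (auto simp: infdist_notempty)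
    obtain a b where ab: "a \<in> A" "b \<in> A" "dist x a < infdist x A + e" "dist y b < infdist y A + e"
      using near[of x] near[of y] by blast
    have "u *\<^sub>R a + v *\<^sub>R b \<in> A"
      using assms(1) ab uv by (simp add: convex_def)
    then have "infdist (u *\<^sub>R x + v *\<^sub>R y) A \<le> norm (u *\<^sub>R (x - a) + v *\<^sub>R (y - b))"
      by (rule infdist_le2) (simp add: dist_norm algebra_simps)
    also have "\<dots> \<le> u * dist x a + v * dist y b"
      using uv norm_triangle_ineq[of "u *\<^sub>R (x - a)" "v *\<^sub>R (y - b)"] by (simp add: dist_norm)
    also have "\<dots> \<le> u * (infdist x A + e) + v * (infdist y A + e)"
      using ab uv by (intro add_mono mult_left_mono) auto
    also have "\<dots> = u * infdist x A + v * infdist y A + e"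
      using uv(3) by (simp add: distrib_left) (metis distrib_right mult_1)
    finally show "infdist (u *\<^sub>R x + v *\<^sub>R y) A \<le> u * infdist x A + v * infdist y A + e" .
  qed
qed simp

lemma weighted_mean_tendsto_0:
  fixes w e :: "nat \<Rightarrow> real"
  assumes w: "\<And>l. 0 \<le> w l" and e: "\<And>l. 0 \<le> e l" "e \<longlonglongrightarrow> 0"
    and W: "filterlim (\<lambda>k. \<Sum>l<k. w l) at_top sequentially"
  shows "(\<lambda>k. (\<Sum>l<k. w l * e l) / (\<Sum>l<k. w l)) \<longlonglongrightarrow> 0"
proof (rule LIMSEQ_I)
  fix r :: real
  assume "0 < r"
  then obtain N where N: "\<And>l. l \<ge> N \<Longrightarrow> e l < r / 2"
    using LIMSEQ_D[OF e(2), of "r / 2"] e(1) by auto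
  define c where "c = (\<Sum>l<N. w l * e l)"
  have c0: "0 \<le> c" unfolding c_def by (intro sum_nonneg mult_nonneg_nonneg w e)
  obtain N' where N': "\<And>k. k \<ge> N' \<Longrightarrow> 2 * c / r + 1 \<le> (\<Sum>l<k. w l)"
    using W unfolding filterlim_at_top eventually_sequentially by meson
  show "\<exists>no. \<forall>k\<ge>no. norm ((\<Sum>l<k. w l * e l) / (\<Sum>l<k. w l) - 0) < r"
  proof (intro exI allI impI)
    fix k
    assume k: "max N N' \<le> k"
    let ?W = "\<Sum>l<k. w l"
    have big: "2 * c / r + 1 \<le> ?W" using N' k by simp
    then have pos: "?W > 0" using c0 \<open>0 < r\<close> by (smt (verit) divide_nonneg_pos mult_nonneg_nonneg)
    have "{..<k} = {..<N} \<union> {N..<k}" using k by auto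
    then have "(\<Sum>l<k. w l * e l) = c + (\<Sum>l=N..<k. w l * e l)"
      by (simp add: c_def sum.union_disjoint ivl_disj_int)
    also have "(\<Sum>l=N..<k. w l * e l) \<le> (\<Sum>l=N..<k. w l * (r / 2))"
      using N w by (intro sum_mono mult_left_mono) (auto intro: less_imp_le)
    also have "\<dots> \<le> (\<Sum>l<k. w l * (r / 2))"
      using w \<open>0 < r\<close> by (intro sum_mono2) auto
    also have "\<dots> = ?W * (r / 2)" by (simp add: sum_distrib_right)
    finally have "(\<Sum>l<k. w l * e l) \<le> c + ?W * (r / 2)" by simp
    also have "c < ?W * (r / 2)"
      using big \<open>0 < r\<close> by (simp add: field_simps)
    finally have "(\<Sum>l<k. w l * e l) < r * ?W" by simp
    moreover have "0 \<le> (\<Sum>l<k. w l * e l)" by (intro sum_nonneg mult_nonneg_nonneg w e)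
    ultimately show "norm ((\<Sum>l<k. w l * e l) / ?W - 0) < r"
      using pos by (simp add: field_simps)
  qed
qed

lemma infdist_weighted_mean_tendsto_0:
  fixes Y :: "nat \<Rightarrow> 'a::real_normed_vector" and w :: "nat \<Rightarrow> real"
  assumes K: "convex K" "K \<noteq> {}" and w: "\<And>l. 0 \<le> w l"
    and W: "filterlim (\<lambda>k. \<Sum>l<k. w l) at_top sequentially"
    and Y: "(\<lambda>l. infdist (Y l) K) \<longlonglongrightarrow> 0"
  shows "(\<lambda>k. infdist ((1 / (\<Sum>l<k. w l)) *\<^sub>R (\<Sum>l<k. w l *\<^sub>R Y l)) K) \<longlonglongrightarrow> 0"
proof (rule tendsto_sandwich[OF always_eventually[OF allI[OF infdist_nonneg]] _ tendsto_const])
  show "(\<lambda>k. (\<Sum>l<k. w l * infdist (Y l) K) / (\<Sum>l<k. w l)) \<longlonglongrightarrow> 0"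
    using weighted_mean_tendsto_0[OF w infdist_nonneg Y W] .
  have "\<forall>\<^sub>F k in sequentially. 1 \<le> (\<Sum>l<k. w l)"
    using W unfolding filterlim_at_top by blast
  then show "\<forall>\<^sub>F k in sequentially. infdist ((1 / (\<Sum>l<k. w l)) *\<^sub>R (\<Sum>l<k. w l *\<^sub>R Y l)) K
      \<le> (\<Sum>l<k. w l * infdist (Y l) K) / (\<Sum>l<k. w l)"
  proof eventually_elim
    case (elim k)
    let ?W = "\<Sum>l<k. w l"
    have "infdist (\<Sum>l<k. (w l / ?W) *\<^sub>R Y l) K \<le> (\<Sum>l<k. w l / ?W * infdist (Y l) K)"
    proof (rule convex_on_sum[OF _ _ convex_on_infdist[OF K]])
      show "{..<k} \<noteq> {}" using elim by (intro notI) simp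
      show "(\<Sum>l<k. w l / ?W) = 1" using elim by (simp flip: sum_divide_distrib)
    qed (use w elim in auto)
    then show ?case
      by (simp add: scaleR_sum_right sum_divide_distrib)
  qed
qed

text \<open>
  Maximizers of a jointly continuous function over a compact set depend upper semicontinuously on
  the parameter: a limit point of maximizers at parameters tending to \<open>t0\<close> is a maximizer at
  \<open>t0\<close>.
\<close>

lemma infdist_argmax_tendsto_0:
  fixes Z :: "'z::first_countable_topology set" and T :: "'t::topological_space set"
    and h :: "'t \<Rightarrow> 'z \<Rightarrow> real" and g :: "'z \<Rightarrow> 'a::metric_space"
  assumes Z: "compact Z" and h: "continuous_on (T \<times> Z) (\<lambda>(t, z). h t z)"
    and g: "continuous_on Z g"
    and t: "t \<longlonglongrightarrow> t0" "\<And>k. t k \<in> T" "t0 \<in> T"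
    and z: "\<And>k. is_arg_max (h (t k)) (\<lambda>z. z \<in> Z) (z k)"
  shows "(\<lambda>k. infdist (g (z k)) (g ` {z. is_arg_max (h t0) (\<lambda>z. z \<in> Z) z})) \<longlonglongrightarrow> 0"
    (is "(\<lambda>k. infdist _ ?A) \<longlonglongrightarrow> 0")
proof (rule ccontr)
  assume "\<not> ?thesis"
  then obtain e where e: "e > 0" and freq: "\<exists>\<^sub>F k in sequentially. e \<le> infdist (g (z k)) ?A"
    by (auto simp: tendsto_iff not_eventually not_less infdist_nonneg)
  then have "infinite {k. e \<le> infdist (g (z k)) ?A}"
    by (simp add: frequently_cofinite flip: cofinite_eq_sequentially)
  then obtain r :: "nat \<Rightarrow> nat" where r: "strict_mono r" "\<And>k. e \<le> infdist (g (z (r k))) ?A"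
    using infinite_enumerate by blast
  have zZ: "z k \<in> Z" for k using z by (simp add: is_arg_max_linorder)
  obtain l s where l: "l \<in> Z" and s: "strict_mono s" and lim: "((\<lambda>k. z (r k)) \<circ> s) \<longlonglongrightarrow> l"
    using compact_imp_seq_compact[OF Z] zZ unfolding seq_compact_def by metis
  define q where "q k = r (s k)" for k
  have q: "strict_mono q" using r(1) s by (auto simp: q_def strict_mono_def)
  have zq: "(\<lambda>k. z (q k)) \<longlonglongrightarrow> l" using lim by (simp add: o_def q_def)
  have tq: "(\<lambda>k. t (q k)) \<longlonglongrightarrow> t0"
    using LIMSEQ_subseq_LIMSEQ[OF t(1) q] by (simp add: o_def)
  have hlim: "(\<lambda>k. h (t (q k)) (y k)) \<longlonglongrightarrow> h t0 y0"
    if "y \<longlonglongrightarrow> y0" "\<And>k. y k \<in> Z" "y0 \<in> Z" for y y0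
    using continuous_on_tendsto_compose[OF h tendsto_Pair[OF tq that(1)]] that t by simp
  have "is_arg_max (h t0) (\<lambda>z. z \<in> Z) l"
    unfolding is_arg_max_linorder
  proof (intro conjI allI impI l)
    fix y
    assume y: "y \<in> Z"
    show "h t0 y \<le> h t0 l"
      by (rule LIMSEQ_le[OF hlim[OF tendsto_const y y] hlim[OF zq zZ l]])
        (use z y in \<open>auto simp: is_arg_max_linorder\<close>)
  qed
  then have "g l \<in> ?A" by blast
  have "(\<lambda>k. dist (g (z (q k))) (g l)) \<longlonglongrightarrow> 0"
    by (intro tendsto_dist_iff[THEN iffD1] continuous_on_tendsto_compose[OF g zq l]) (simp add: zZ)
  moreover have "e \<le> dist (g (z (q k))) (g l)" for k
    using r(2)[of "s k"] infdist_le[OF \<open>g l \<in> ?A\<close>, of "g (z (q k))"] by (simp add: q_def)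
  ultimately have "e \<le> 0" by (intro LIMSEQ_le_const) auto
  then show False using e by simp
qed

lemma liminf_ge_of_infdist_tendsto_0:
  fixes M :: "nat \<Rightarrow> 'a::heine_borel" and g :: "'a \<Rightarrow> real"
  assumes K: "compact K" "K \<noteq> {}" and g: "continuous_on UNIV g"
    and ge: "\<And>A. A \<in> K \<Longrightarrow> d \<le> g A"
    and lim: "(\<lambda>k. infdist (M k) K) \<longlonglongrightarrow> 0"
  shows "ereal d \<le> liminf (\<lambda>k. ereal (g (M k)))"
  unfolding le_Liminf_iff
proof (intro allI impI)
  fix y :: ereal
  assume "y < ereal d"
  then obtain c where c: "y < ereal c" "c < d"
    using ereal_dense2[of y "ereal d"] by auto
  have "open {A. c < g A}"
    by (intro open_Collect_less continuous_on_const g)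
  moreover have "K \<subseteq> {A. c < g A}" using ge c(2) by force
  ultimately obtain e where e: "e > 0" "(\<Union>A\<in>K. ball A e) \<subseteq> {A. c < g A}"
    using compact_subset_open_imp_ball_epsilon_subset[OF K(1)] by metis
  have "\<forall>\<^sub>F k in sequentially. infdist (M k) K < e"
    using order_tendstoD(2)[OF lim e(1)] .
  then show "\<forall>\<^sub>F k in sequentially. y < ereal (g (M k))"
  proof eventually_elim
    case (elim k)
    obtain A where "A \<in> K" "infdist (M k) K = dist (M k) A"
      using infdist_attains_inf[OF compact_imp_closed[OF K(1)] K(2)] by metis
    then have "M k \<in> ball A e" using elim by (simp add: dist_commute)
    then have "M k \<in> {A. c < g A}" using e(2) \<open>A \<in> K\<close> by blast
    then have "ereal c < ereal (g (M k))" by simp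
    then show ?case using c(1) by (rule order.strict_trans[rotated])
  qed
qed

section \<open>Information matrices\<close>

text \<open>
  The matrix \<open>v v\<^sup>T\<close>, the information matrix of a single observation with regression vector v.
\<close>

definition outer :: "real ^ 'p \<Rightarrow> real ^ 'p ^ 'p" where
  "outer v = (\<chi> i j. v $ i * v $ j)"

text \<open>
  The information matrix of p observations at the points \<open>z j\<close>, with equal weights. It is defined
  for every tuple of points, also with repetitions.
\<close>

definition uniform_info :: "('t \<Rightarrow> 'x \<Rightarrow> real ^ 'p) \<Rightarrow> 't \<Rightarrow> ('p \<Rightarrow> 'x) \<Rightarrow> real ^ 'p ^ 'p" where
  "uniform_info f \<theta> z = (1 / CARD('p)) *\<^sub>R (\<Sum>j\<in>UNIV. outer (f \<theta> (z j)))"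

lemma info_matrix_eq_integral:
  fixes f :: "'t \<Rightarrow> 'x \<Rightarrow> real ^ 'p"
  assumes "finite (set_pmf \<xi>)"
  shows "info_matrix f \<xi> \<theta> = (LINT x|\<xi>. outer (f \<theta> x))"
  unfolding info_matrix_def outer_def using assms by (intro integral_measure_pmf[symmetric]) auto

lemma info_matrix_map_pmf:
  fixes f :: "'t \<Rightarrow> 'x \<Rightarrow> real ^ 'p"
  assumes "finite (set_pmf \<mu>)"
  shows "info_matrix f (map_pmf z \<mu>) \<theta> = (\<Sum>a\<in>set_pmf \<mu>. pmf \<mu> a *\<^sub>R outer (f \<theta> (z a)))"
  using assms by (simp add: info_matrix_eq_integral integral_measure_pmf[of "set_pmf \<mu>"])

lemma info_matrix_uniform:
  fixes f :: "'t \<Rightarrow> 'x \<Rightarrow> real ^ 'p"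
  shows "info_matrix f (map_pmf z (pmf_of_set (UNIV :: 'p set))) \<theta> = uniform_info f \<theta> z"
  by (simp add: info_matrix_map_pmf uniform_info_def scaleR_sum_right)

lemma info_matrix_empirical:
  fixes f :: "'t \<Rightarrow> 'x \<Rightarrow> real ^ 'p"
  assumes "n \<ge> 1"
  shows "info_matrix f (empirical_design x n) \<theta> = (1 / n) *\<^sub>R (\<Sum>i=1..n. outer (f \<theta> (x i)))"
  using assms by (simp add: empirical_design_def info_matrix_map_pmf scaleR_sum_right)

lemma outer_mult_vec: "outer v *v x = (v \<bullet> x) *\<^sub>R v"
  by (simp add: outer_def matrix_vector_mult_def vec_eq_iff inner_vec_def sum_distrib_left
      sum_distrib_right mult_ac)

lemma info_matrix_mult_vec:
  fixes f :: "'t \<Rightarrow> 'x \<Rightarrow> real ^ 'p"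
  shows "info_matrix f \<xi> \<theta> *v x = (\<Sum>a\<in>set_pmf \<xi>. (pmf \<xi> a * (f \<theta> a \<bullet> x)) *\<^sub>R f \<theta> a)"
proof -
  have "(\<Sum>a\<in>S. pmf \<xi> a *\<^sub>R outer (f \<theta> a)) *v x
      = (\<Sum>a\<in>S. (pmf \<xi> a * (f \<theta> a \<bullet> x)) *\<^sub>R f \<theta> a)" for S
    by (induction S rule: infinite_finite_induct)
      (simp_all add: matrix_vector_mult_add_rdistrib outer_mult_vec scaleR_matrix_vector_assoc[symmetric])
  then show ?thesis by (simp add: info_matrix_def outer_def)
qed

lemma pos_def_info_matrix:
  fixes f :: "'t \<Rightarrow> 'x \<Rightarrow> real ^ 'p"
  assumes fin: "finite (set_pmf \<xi>)" and det: "det (info_matrix f \<xi> \<theta>) \<noteq> 0"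
  shows "pos_def (info_matrix f \<xi> \<theta>)"
proof -
  let ?A = "info_matrix f \<xi> \<theta>"
  have "transpose ?A = ?A"
    by (simp add: info_matrix_def transpose_def vec_eq_iff mult.commute)
  moreover have "0 < x \<bullet> (?A *v x)" if "x \<noteq> 0" for x
  proof -
    have eq: "x \<bullet> (?A *v x) = (\<Sum>a\<in>set_pmf \<xi>. pmf \<xi> a * (f \<theta> a \<bullet> x)\<^sup>2)"
      by (simp add: info_matrix_mult_vec inner_sum_right power2_eq_square inner_commute mult_ac)
    have "x \<bullet> (?A *v x) \<noteq> 0"
    proof
      assume "x \<bullet> (?A *v x) = 0"
      then have "\<forall>a\<in>set_pmf \<xi>. pmf \<xi> a * (f \<theta> a \<bullet> x)\<^sup>2 = 0"
        unfolding eq by (subst (asm) sum_nonneg_eq_0_iff[OF fin]) auto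
      then have "?A *v x = 0"
        by (auto simp: info_matrix_mult_vec intro!: sum.neutral)
      moreover have "inj ((*v) ?A)"
        using det by (simp add: invertible_det_nz[symmetric] inj_matrix_vector_mult)
      ultimately show False
        using that by (metis injD matrix_vector_mult_0_right)
    qed
    moreover have "0 \<le> x \<bullet> (?A *v x)"
      unfolding eq by (intro sum_nonneg) auto
    ultimately show ?thesis by simp
  qed
  ultimately show ?thesis by (simp add: pos_def_def)
qed

text \<open>
  The sum is the information matrix with weights \<open>w\<close> at p points; it is a Gram matrix of
  rescaled regression vectors.
\<close>

lemma det_weighted_outer_sum:
  fixes f :: "'t \<Rightarrow> 'x \<Rightarrow> real ^ 'p" and z :: "'p \<Rightarrow> 'x" and \<theta> :: 't
  assumes "\<And>j. 0 \<le> w j"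
  shows "det (\<Sum>j\<in>UNIV. w j *\<^sub>R outer (f \<theta> (z j)))
    = prod w UNIV * (det (column_matrix f \<theta> z))\<^sup>2"
proof -
  define D where "D = (\<chi> j. sqrt (w j) *s f \<theta> (z j))"
  have sq: "sqrt (w j) * (sqrt (w j) * c) = w j * c" for j c
    using assms(1)[of j] by (simp flip: mult.assoc)
  have eq: "(\<Sum>j\<in>UNIV. w j *\<^sub>R outer (f \<theta> (z j))) = transpose D ** D"
    by (simp add: vec_eq_iff D_def transpose_def matrix_matrix_mult_def outer_def mult_ac sq)
  have "det D = (\<Prod>j\<in>UNIV. sqrt (w j)) * det (transpose (column_matrix f \<theta> z))"
    unfolding D_def det_rows_mul by (simp add: transpose_def column_matrix_def vec_lambda_eta)
  then have "det (transpose D ** D) = (\<Prod>j\<in>UNIV. sqrt (w j))\<^sup>2 * (det (column_matrix f \<theta> z))\<^sup>2"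
    by (simp add: det_mul power2_eq_square)
  also have "(\<Prod>j\<in>UNIV. sqrt (w j))\<^sup>2 = prod w UNIV"
    using assms(1) by (simp add: prod_power_distrib)
  finally show ?thesis
    by (simp add: eq)
qed

lemma det_uniform_info:
  fixes f :: "'t \<Rightarrow> 'x \<Rightarrow> real ^ 'p"
  shows "det (uniform_info f \<theta> z) = (1 / CARD('p)) ^ CARD('p) * (det (column_matrix f \<theta> z))\<^sup>2"
  using det_weighted_outer_sum[of "\<lambda>_. 1 / CARD('p)" f \<theta> z]
  by (simp add: uniform_info_def scaleR_sum_right)

text \<open>
  The inequality of arithmetic and geometric means, with its case of equality, from the
  determinants of diagonal matrices.
\<close>

lemma prod_le_1_of_sum_eq_card:
  fixes w :: "'n::finite \<Rightarrow> real"
  assumes nonneg: "\<And>j. 0 \<le> w j" and sum: "sum w UNIV = CARD('n)"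
  shows "prod w UNIV \<le> 1" and "prod w UNIV = 1 \<Longrightarrow> w j = 1"
proof -
  let ?I = "mat 1 :: real ^ 'n ^ 'n"
  let ?E = "\<chi> j. sqrt (w j) *s ?I $ j"
  have I: "pos_def ?I" by (simp add: pos_def_def transpose_mat)
  have entry: "(?I $ i) \<bullet> (?I $ j) = (if i = j then 1 else 0)" for i j
  proof -
    have "?I $ k = axis k 1" for k by (simp add: mat_def axis_def vec_eq_iff)
    then show ?thesis by (simp add: inner_axis_axis)
  qed
  have "row_form_sum ?I ?E = CARD('n)"
    using nonneg by (simp add: row_form_sum_def scalar_mult_eq_scaleR entry sum)
  then have le: "row_form_sum ?I ?E \<le> CARD('n)" by simp
  have det: "(det ?E)\<^sup>2 = prod w UNIV"
    using nonneg by (simp add: det_rows_mul prod_power_distrib)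
  show "prod w UNIV \<le> 1"
    using det_sq_mult_det_le_1[OF I le] by (simp add: det)
  assume "prod w UNIV = 1"
  then have "(det ?E)\<^sup>2 * det ?I = 1" unfolding det by simp
  then have "?E ** ?I ** transpose ?E = mat 1" by (rule det_sq_mult_det_eq_1[OF I le])
  then have "(?E ** ?I ** transpose ?E) $ j $ j = 1" by (simp add: mat_def)
  then show "w j = 1"
    using nonneg unfolding congruence_entry by (simp add: scalar_mult_eq_scaleR entry)
qed

lemma saturated_design_uniform:
  fixes z :: "'p::finite \<Rightarrow> 'x"
  assumes "inj z" "range z \<subseteq> R"
  shows "saturated_design CARD('p) R (map_pmf z (pmf_of_set UNIV))"
  using assms by (auto simp: saturated_design_def design_def card_image)

lemma det_column_matrix_imp_inj:
  fixes f :: "'t \<Rightarrow> 'x \<Rightarrow> real ^ 'p"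
  assumes "det (column_matrix f \<theta> z) \<noteq> 0"
  shows "inj z"
proof (rule injI, rule ccontr)
  fix i j assume "z i = z j" "i \<noteq> j"
  then have "det (column_matrix f \<theta> z) = 0"
    by (intro det_identical_columns[of i j]) (auto simp: column_def column_matrix_def)
  then show False using assms by simp
qed

text \<open>
  On p given points, equal weights are optimal, and they are the only optimal weights unless the
  determinant vanishes for all weights.
\<close>

lemma det_saturated_le:
  fixes f :: "'t \<Rightarrow> 'x \<Rightarrow> real ^ 'p"
  assumes "saturated_design CARD('p) R \<eta>"
  obtains z where "range z \<subseteq> R" "det (info_matrix f \<eta> \<theta>) \<le> det (uniform_info f \<theta> z)"
    "det (info_matrix f \<eta> \<theta>) = det (uniform_info f \<theta> z) \<Longrightarrow> det (uniform_info f \<theta> z) \<noteq> 0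
      \<Longrightarrow> info_matrix f \<eta> \<theta> = uniform_info f \<theta> z"
proof -
  have fin: "finite (set_pmf \<eta>)" and sub: "set_pmf \<eta> \<subseteq> R" and card: "card (set_pmf \<eta>) = CARD('p)"
    using assms by (auto simp: saturated_design_def design_def)
  obtain z :: "'p \<Rightarrow> 'x" where z: "bij_betw z UNIV (set_pmf \<eta>)"
    using finite_same_card_bij[of "UNIV :: 'p set" "set_pmf \<eta>"] fin card by auto
  have zR: "range z \<subseteq> R" using z sub by (auto simp: bij_betw_def)
  define w where "w j = pmf \<eta> (z j)" for j
  have w0: "0 \<le> w j" for j by (simp add: w_def)
  have "sum w UNIV = sum (pmf \<eta>) (set_pmf \<eta>)"
    unfolding w_def using sum.reindex_bij_betw[OF z] .
  also have "\<dots> = 1" using sum_pmf_eq_1[OF fin] by simp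
  finally have "(\<Sum>j\<in>UNIV. CARD('p) * w j) = CARD('p)" by (simp flip: sum_distrib_left)
  note amgm = prod_le_1_of_sum_eq_card[of "\<lambda>j. CARD('p) * w j", OF _ this]
  have info: "info_matrix f \<eta> \<theta> = (\<Sum>j\<in>UNIV. w j *\<^sub>R outer (f \<theta> (z j)))"
    unfolding info_matrix_def outer_def w_def 
    by (rule sum.reindex_bij_betw[OF z, symmetric])
  let ?P = "\<Prod>j\<in>UNIV. CARD('p) * w j"
  have "det (info_matrix f \<eta> \<theta>) = prod w UNIV * (det (column_matrix f \<theta> z))\<^sup>2"
    unfolding info by (rule det_weighted_outer_sum) (rule w0)
  also have "prod w UNIV = ?P * (1 / CARD('p)) ^ CARD('p)"
    by (simp add: prod.distrib power_divide)
  finally have det: "det (info_matrix f \<eta> \<theta>) = ?P * det (uniform_info f \<theta> z)"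
    by (simp add: det_uniform_info)
  have nonneg: "0 \<le> det (uniform_info f \<theta> z)" by (simp add: det_uniform_info)
  have P0: "0 \<le> ?P" by (intro prod_nonneg) (simp add: w0)
  have P1: "?P \<le> 1" by (rule amgm(1)) (simp add: w0)
  show thesis
  proof (rule that[OF zR])
    show "det (info_matrix f \<eta> \<theta>) \<le> det (uniform_info f \<theta> z)"
      unfolding det by (rule mult_left_le_one_le[OF nonneg P0 P1])
    assume "det (info_matrix f \<eta> \<theta>) = det (uniform_info f \<theta> z)" "det (uniform_info f \<theta> z) \<noteq> 0"
    then have "?P = 1" using det by simp
    then have "CARD('p) * w j = 1" for j by (rule amgm(2)[rotated]) (simp add: w0)
    then have "w j = 1 / CARD('p)" for j by (simp add: field_simps)
    then show "info_matrix f \<eta> \<theta> = uniform_info f \<theta> z"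
      by (simp add: info uniform_info_def scaleR_sum_right)
  qed
qed

section \<open>Optimal saturated designs and uniqueness\<close>

text \<open>
  The p-tuples of points that maximize the squared determinant of their regression vectors, hence
  the possible outcomes of a step of the algorithm with estimate \<open>\<theta>\<close>.
\<close>

definition det_maximizers ::
    "'x set \<Rightarrow> ('t \<Rightarrow> 'x \<Rightarrow> real ^ 'p) \<Rightarrow> 't \<Rightarrow> ('p \<Rightarrow> 'x) set" where
  "det_maximizers R f \<theta> =
     {z. is_arg_max (\<lambda>z. (det (column_matrix f \<theta> z))\<^sup>2) (\<lambda>z. range z \<subseteq> R) z}"

lemma compact_range_subset:
  assumes "compact R"
  shows "compact {z :: 'p::finite \<Rightarrow> 'x::topological_space. range z \<subseteq> R}"
proof -
  have "{z :: 'p \<Rightarrow> 'x. range z \<subseteq> R} = PiE UNIV (\<lambda>_. R)"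
    by (auto simp: PiE_def Pi_def)
  moreover have "compactin (product_topology (\<lambda>_. euclidean) UNIV) (PiE (UNIV :: 'p set) (\<lambda>_. R))"
    using assms by (simp add: compactin_PiE)
  ultimately show ?thesis by (simp add: euclidean_product_topology)
qed

lemma continuous_on_regression_coord:
  fixes f :: "'t::topological_space \<Rightarrow> 'x::topological_space \<Rightarrow> real ^ 'p"
  assumes "continuous_on (R \<times> \<Theta>) (\<lambda>(x, \<theta>). f \<theta> x)"
  shows "continuous_on (\<Theta> \<times> {z. range z \<subseteq> R}) (\<lambda>(\<theta>, z). f \<theta> (z (j :: 'p)))"
proof -
  have "continuous_on (\<Theta> \<times> {z. range z \<subseteq> R}) (\<lambda>p. (snd p j, fst p))"
    by (intro continuous_intros continuous_on_product_then_coordinatewise[where f = snd])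
  moreover have "(\<lambda>p. (snd p j, fst p)) ` (\<Theta> \<times> {z. range z \<subseteq> R}) \<subseteq> R \<times> \<Theta>"
    by auto
  ultimately have "continuous_on (\<Theta> \<times> {z. range z \<subseteq> R})
      (\<lambda>p. (\<lambda>(x, \<theta>). f \<theta> x) (snd p j, fst p))"
    by (rule continuous_on_compose2[OF assms])
  then show ?thesis by (simp add: case_prod_unfold)
qed

lemma continuous_on_det_column_matrix:
  fixes f :: "'t::topological_space \<Rightarrow> 'x::topological_space \<Rightarrow> real ^ 'p"
  assumes "continuous_on (R \<times> \<Theta>) (\<lambda>(x, \<theta>). f \<theta> x)"
  shows "continuous_on (\<Theta> \<times> {z. range z \<subseteq> R}) (\<lambda>(\<theta>, z). (det (column_matrix f \<theta> z))\<^sup>2)"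
  unfolding column_matrix_def case_prod_unfold
  by (intro continuous_intros continuous_on_det continuous_on_vec_lambda
      continuous_on_regression_coord[OF assms, unfolded case_prod_unfold])

lemma continuous_on_uniform_info:
  fixes f :: "'t::topological_space \<Rightarrow> 'x::topological_space \<Rightarrow> real ^ 'p"
  assumes "continuous_on R (f \<theta>)"
  shows "continuous_on {z. range z \<subseteq> R} (uniform_info f \<theta>)"
proof -
  have "continuous_on {z. range z \<subseteq> R} (\<lambda>z. f \<theta> (z j))" for j :: 'p
    by (rule continuous_on_compose2[OF assms]) (auto intro: continuous_on_product_then_coordinatewise continuous_on_id)
  then show ?thesis
    unfolding uniform_info_def outer_def
    by (intro continuous_intros continuous_on_vec_lambda)
qed

lemma exists_det_column_matrix_nonzero:
  fixes f :: "'t \<Rightarrow> 'x \<Rightarrow> real ^ 'p"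
  assumes "span (f \<theta> ` R) = UNIV"
  obtains z where "range z \<subseteq> R" "det (column_matrix f \<theta> z) \<noteq> 0"
proof -
  obtain B where B: "B \<subseteq> f \<theta> ` R" "independent B" "f \<theta> ` R \<subseteq> span B" "card B = dim (f \<theta> ` R)"
    using basis_exists[of "f \<theta> ` R"] by metis
  have spanB: "span B = UNIV"
    using B(3) assms by (metis span_mono span_span top.extremum_uniqueI)
  have "dim (f \<theta> ` R) = CARD('p)"
    using dim_span[of "f \<theta> ` R"] assms by simp
  then have "card B = CARD('p)" "finite B"
    using B(4) independent_imp_finite[OF B(2)] by auto
  then obtain b :: "'p \<Rightarrow> real ^ 'p" where b: "bij_betw b UNIV B"
    using finite_same_card_bij[of "UNIV :: 'p set" B] by auto
  have "\<exists>x\<in>R. f \<theta> x = b j" for j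
  proof -
    have "b j \<in> f \<theta> ` R" using b B(1) by (auto simp: bij_betw_def)
    then show ?thesis by auto
  qed
  then obtain z where z: "\<And>j. z j \<in> R" "\<And>j. f \<theta> (z j) = b j" by metis
  let ?C = "transpose (column_matrix f \<theta> z)"
  have "rows ?C = B"
    using b by (auto simp: rows_def row_def transpose_def column_matrix_def z bij_betw_def vec_lambda_eta)
  then have "\<exists>A. A ** ?C = mat 1" by (simp add: matrix_left_invertible_span_rows spanB)
  then have "invertible ?C" by (simp add: invertible_left_inverse)
  then have "det (column_matrix f \<theta> z) \<noteq> 0" by (simp add: invertible_det_nz)
  then show thesis using that z(1) by blast
qed

lemma det_maximizers_properties:
  fixes f :: "'t::topological_space \<Rightarrow> 'x::topological_space \<Rightarrow> real ^ 'p"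
  assumes R: "compact R" and f: "continuous_on R (f \<theta>)" and span: "span (f \<theta> ` R) = UNIV"
  shows det_maximizers_nonempty: "det_maximizers R f \<theta> \<noteq> {}"
    and det_maximizers_nonzero: "z \<in> det_maximizers R f \<theta> \<Longrightarrow> det (column_matrix f \<theta> z) \<noteq> 0"
proof -
  let ?Z = "{z :: 'p \<Rightarrow> 'x. range z \<subseteq> R}"
  obtain z1 where z1: "range z1 \<subseteq> R" "det (column_matrix f \<theta> z1) \<noteq> 0"
    using exists_det_column_matrix_nonzero[where f = f, OF span] by blast
  have cont: "continuous_on ?Z (\<lambda>z. det (uniform_info f \<theta> z))"
    by (rule continuous_on_det[OF continuous_on_uniform_info[where f = f, OF f]])
  have ne: "?Z \<noteq> {}" using z1(1) by blast
  obtain z0 where "z0 \<in> ?Z" "\<forall>z\<in>?Z. det (uniform_info f \<theta> z) \<le> det (uniform_info f \<theta> z0)"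
    by (rule bexE[OF continuous_attains_sup[OF compact_range_subset[OF R] ne cont]])
  then have "z0 \<in> det_maximizers R f \<theta>"
    by (simp add: det_maximizers_def is_arg_max_linorder det_uniform_info)
  then show "det_maximizers R f \<theta> \<noteq> {}" by blast
  assume "z \<in> det_maximizers R f \<theta>"
  then have "(det (column_matrix f \<theta> z1))\<^sup>2 \<le> (det (column_matrix f \<theta> z))\<^sup>2"
    using z1(1) by (simp add: det_maximizers_def is_arg_max_linorder)
  then show "det (column_matrix f \<theta> z) \<noteq> 0" using z1(2) by auto
qed

text \<open>
  The locally D-optimal saturated designs are the uniform designs on the maximizing tuples; a
  maximizing tuple has p distinct points, because its determinant is not zero.
\<close>

lemma saturated_optimum:
  fixes f :: "'t::topological_space \<Rightarrow> 'x::topological_space \<Rightarrow> real ^ 'p"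
  assumes R: "compact R" and f: "continuous_on R (f \<theta>)" and span: "span (f \<theta> ` R) = UNIV"
    and z0: "z0 \<in> det_maximizers R f \<theta>"
  defines "m \<equiv> det (uniform_info f \<theta> z0)"
  shows "0 < m"
    and "locally_D_optimal_saturated R f \<theta> \<eta> \<longleftrightarrow>
      saturated_design CARD('p) R \<eta> \<and> det (info_matrix f \<eta> \<theta>) = m"
    and "uniform_info f \<theta> z0 \<in> D_opt_sat_infos R f \<theta>"
    and "locally_D_optimal_saturated R f \<theta> \<eta> \<Longrightarrow> info_matrix f \<eta> \<theta> \<in> uniform_info f \<theta> ` det_maximizers R f \<theta>"
proof -
  have nz: "det (column_matrix f \<theta> z0) \<noteq> 0"
    by (rule det_maximizers_nonzero[where f = f, OF R f span z0])
  then show m: "0 < m" by (simp add: m_def det_uniform_info)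
  have max: "det (uniform_info f \<theta> z) \<le> m" if "range z \<subseteq> R" for z
    using z0 that by (simp add: m_def det_uniform_info det_maximizers_def is_arg_max_linorder)
  let ?\<eta>0 = "map_pmf z0 (pmf_of_set (UNIV :: 'p set))"
  have "range z0 \<subseteq> R" using z0 by (simp add: det_maximizers_def is_arg_max_linorder)
  then have \<eta>0: "saturated_design CARD('p) R ?\<eta>0"
    using det_column_matrix_imp_inj[OF nz] by (intro saturated_design_uniform)
  have le: "det (info_matrix f \<eta> \<theta>) \<le> m" if "saturated_design CARD('p) R \<eta>" for \<eta>
    using det_saturated_le[OF that, of f \<theta>] max by (metis order.trans)
  show iff: "locally_D_optimal_saturated R f \<theta> \<eta> \<longleftrightarrow>
      saturated_design CARD('p) R \<eta> \<and> det (info_matrix f \<eta> \<theta>) = m" for \<eta>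
  proof
    assume opt: "locally_D_optimal_saturated R f \<theta> \<eta>"
    then have "det (info_matrix f ?\<eta>0 \<theta>) \<le> det (info_matrix f \<eta> \<theta>)"
      using \<eta>0 by (auto simp: locally_D_optimal_saturated_def is_arg_max_linorder)
    then show "saturated_design CARD('p) R \<eta> \<and> det (info_matrix f \<eta> \<theta>) = m"
      using opt le[of \<eta>]
      by (auto simp: locally_D_optimal_saturated_def is_arg_max_linorder info_matrix_uniform m_def)
  next
    assume "saturated_design CARD('p) R \<eta> \<and> det (info_matrix f \<eta> \<theta>) = m"
    then show "locally_D_optimal_saturated R f \<theta> \<eta>"
      using le by (simp add: locally_D_optimal_saturated_def is_arg_max_linorder)
  qed
  have "locally_D_optimal_saturated R f \<theta> ?\<eta>0"
    using \<eta>0 by (simp add: iff info_matrix_uniform m_def)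
  then show "uniform_info f \<theta> z0 \<in> D_opt_sat_infos R f \<theta>"
    unfolding D_opt_sat_infos_def mem_Collect_eq
    by (intro exI[of _ ?\<eta>0] conjI) (simp add: info_matrix_uniform)
  assume "locally_D_optimal_saturated R f \<theta> \<eta>"
  then have \<eta>: "saturated_design CARD('p) R \<eta>" "det (info_matrix f \<eta> \<theta>) = m" by (simp_all add: iff)
  obtain z where z: "range z \<subseteq> R" "m \<le> det (uniform_info f \<theta> z)"
    "m = det (uniform_info f \<theta> z) \<Longrightarrow> det (uniform_info f \<theta> z) \<noteq> 0
      \<Longrightarrow> info_matrix f \<eta> \<theta> = uniform_info f \<theta> z"
    by (rule det_saturated_le[OF \<eta>(1), of f \<theta>]) (simp add: \<eta>(2))
  have zm: "det (uniform_info f \<theta> z) = m" using z(2) max[OF z(1)] by simp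
  have "(det (column_matrix f \<theta> z))\<^sup>2 = (det (column_matrix f \<theta> z0))\<^sup>2"
    using zm by (simp add: m_def det_uniform_info)
  then have "z \<in> det_maximizers R f \<theta>"
    using z0 z(1) unfolding det_maximizers_def is_arg_max_linorder mem_Collect_eq by metis
  moreover have "info_matrix f \<eta> \<theta> = uniform_info f \<theta> z" using z(3) zm m by simp
  ultimately show "info_matrix f \<eta> \<theta> \<in> uniform_info f \<theta> ` det_maximizers R f \<theta>" by blast
qed

lemma D_opt_sat_infos_eq:
  fixes f :: "'t::topological_space \<Rightarrow> 'x::topological_space \<Rightarrow> real ^ 'p"
  assumes "compact R" and "continuous_on R (f \<theta>)" and "span (f \<theta> ` R) = UNIV"
  shows "D_opt_sat_infos R f \<theta> = uniform_info f \<theta> ` det_maximizers R f \<theta>"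
proof -
  obtain z0 where z0: "z0 \<in> det_maximizers R f \<theta>"
    using det_maximizers_nonempty[where f = f, OF assms] by blast
  show ?thesis
  proof (intro equalityI subsetI)
    fix A assume "A \<in> D_opt_sat_infos R f \<theta>"
    then obtain \<eta> where "locally_D_optimal_saturated R f \<theta> \<eta>" "A = info_matrix f \<eta> \<theta>"
      by (auto simp: D_opt_sat_infos_def)
    then show "A \<in> uniform_info f \<theta> ` det_maximizers R f \<theta>"
      using saturated_optimum(4)[where f = f, OF assms z0] by simp
  next
    fix A assume "A \<in> uniform_info f \<theta> ` det_maximizers R f \<theta>"
    then obtain z where z: "z \<in> det_maximizers R f \<theta>" "A = uniform_info f \<theta> z" by blast
    show "A \<in> D_opt_sat_infos R f \<theta>"
      unfolding z(2) by (rule saturated_optimum(3)[where f = f, OF assms z(1)])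
  qed
qed

lemma D_opt_sat_value_eq:
  fixes f :: "'t \<Rightarrow> 'x \<Rightarrow> real ^ 'p"
  assumes "locally_D_optimal_saturated R f \<theta> \<eta>"
  shows "D_opt_sat_value R f \<theta> = det (info_matrix f \<eta> \<theta>)"
  unfolding D_opt_sat_value_def using assms
  by (intro Greatest_equality) (auto simp: locally_D_optimal_saturated_def is_arg_max_linorder)

lemma D_opt_value_eq:
  fixes f :: "'t \<Rightarrow> 'x \<Rightarrow> real ^ 'p"
  assumes "locally_D_optimal R f \<theta> \<eta>"
  shows "D_opt_value R f \<theta> = det (info_matrix f \<eta> \<theta>)"
  unfolding D_opt_value_def using assms
  by (intro Greatest_equality) (auto simp: locally_D_optimal_def is_arg_max_linorder)

lemma compact_D_opt_sat_infos:
  fixes f :: "'t::topological_space \<Rightarrow> 'x::metric_space \<Rightarrow> real ^ 'p"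
  assumes "compact R" and "continuous_on R (f \<theta>)" and "span (f \<theta> ` R) = UNIV"
  shows "compact (D_opt_sat_infos R f \<theta>)"
proof -
  let ?Z = "{z :: 'p \<Rightarrow> 'x. range z \<subseteq> R}"
  obtain z0 where z0: "z0 \<in> det_maximizers R f \<theta>"
    using det_maximizers_nonempty[where f = f, OF assms] by blast
  have "z \<in> det_maximizers R f \<theta> \<longleftrightarrow>
      range z \<subseteq> R \<and> det (uniform_info f \<theta> z) = det (uniform_info f \<theta> z0)" for z
  proof -
    have "z \<in> det_maximizers R f \<theta> \<longleftrightarrow>
      range z \<subseteq> R \<and> (det (column_matrix f \<theta> z))\<^sup>2 = (det (column_matrix f \<theta> z0))\<^sup>2"
      using z0 unfolding det_maximizers_def is_arg_max_linorder mem_Collect_eq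
      by (metis order.antisym)
    then show ?thesis by (simp add: det_uniform_info)
  qed
  then have "uniform_info f \<theta> ` det_maximizers R f \<theta>
      = uniform_info f \<theta> ` ?Z \<inter> {A. det A = det (uniform_info f \<theta> z0)}" (is "_ = ?K")
    by auto
  moreover have "compact ?K"
  proof (rule compact_Int_closed)
    show "compact (uniform_info f \<theta> ` ?Z)"
      by (intro compact_continuous_image continuous_on_uniform_info compact_range_subset assms)
    show "closed {A :: real^'p^'p. det A = det (uniform_info f \<theta> z0)}"
      by (intro closed_Collect_eq continuous_on_det continuous_on_id continuous_on_const)
  qed
  ultimately show ?thesis by (simp add: D_opt_sat_infos_eq[where f = f, OF assms])
qed

lemma info_matrix_midpoint:
  fixes f :: "'t \<Rightarrow> 'x \<Rightarrow> real ^ 'p"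
  assumes "design R \<xi>" "design R \<eta>"
  obtains \<zeta> where "design R \<zeta>"
    "info_matrix f \<zeta> \<theta> = (1/2) *\<^sub>R info_matrix f \<xi> \<theta> + (1/2) *\<^sub>R info_matrix f \<eta> \<theta>"
proof -
  define \<zeta> where "\<zeta> = bind_pmf (bernoulli_pmf (1/2)) (\<lambda>b. if b then \<xi> else \<eta>)"
  let ?S = "set_pmf \<xi> \<union> set_pmf \<eta>"
  have set: "set_pmf \<zeta> = ?S"
    by (auto simp: \<zeta>_def split: if_splits)
  have pmf: "pmf \<zeta> x = (1/2) * pmf \<xi> x + (1/2) * pmf \<eta> x" for x
    by (simp add: \<zeta>_def pmf_bind)
  have fin: "finite ?S" using assms by (simp add: design_def)
  have info: "info_matrix f \<mu> \<theta> = (\<Sum>a\<in>?S. pmf \<mu> a *\<^sub>R outer (f \<theta> a))" if "set_pmf \<mu> \<subseteq> ?S" for \<mu>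
    using that fin by (subst info_matrix_eq_integral) (auto intro: finite_subset integral_measure_pmf)
  have "info_matrix f \<zeta> \<theta> = (1/2) *\<^sub>R info_matrix f \<xi> \<theta> + (1/2) *\<^sub>R info_matrix f \<eta> \<theta>"
    by (simp add: info set pmf scaleR_left_distrib sum.distrib scaleR_sum_right)
  moreover have "design R \<zeta>" using assms by (simp add: design_def set)
  ultimately show thesis using that by blast
qed

text \<open>
  The midpoint of two different optimal information matrices would be the information matrix of a
  strictly better design.
\<close>

lemma D_optimal_info_unique:
  fixes f :: "'t \<Rightarrow> 'x \<Rightarrow> real ^ 'p"
  assumes opt: "locally_D_optimal R f \<theta> \<xi>" "locally_D_optimal R f \<theta> \<eta>"
    and nz: "det (info_matrix f \<xi> \<theta>) \<noteq> 0"
  shows "info_matrix f \<xi> \<theta> = info_matrix f \<eta> \<theta>"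
proof (rule ccontr)
  assume neq: "\<not> ?thesis"
  have d: "design R \<xi>" "design R \<eta>"
    and max: "\<And>\<zeta>. design R \<zeta> \<Longrightarrow> det (info_matrix f \<zeta> \<theta>) \<le> det (info_matrix f \<xi> \<theta>)"
    and max': "\<And>\<zeta>. design R \<zeta> \<Longrightarrow> det (info_matrix f \<zeta> \<theta>) \<le> det (info_matrix f \<eta> \<theta>)"
    using opt by (simp_all add: locally_D_optimal_def is_arg_max_linorder)
  have eq: "det (info_matrix f \<xi> \<theta>) = det (info_matrix f \<eta> \<theta>)"
    by (intro antisym max max' d)
  obtain \<zeta> where \<zeta>: "design R \<zeta>"
    "info_matrix f \<zeta> \<theta> = (1/2) *\<^sub>R info_matrix f \<xi> \<theta> + (1/2) *\<^sub>R info_matrix f \<eta> \<theta>"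
    by (rule info_matrix_midpoint[OF d])
  have "min (det (info_matrix f \<xi> \<theta>)) (det (info_matrix f \<eta> \<theta>)) < det (info_matrix f \<zeta> \<theta>)"
    unfolding \<zeta>(2)
    by (intro det_strict_quasiconcave pos_def_info_matrix neq) (use d nz eq in \<open>auto simp: design_def\<close>)
  then show False using max[OF \<zeta>(1)] eq by simp
qed

section \<open>The generated designs\<close>

text \<open>
  The p points that follow the first n points of the sequence, as a tuple indexed by the type of
  coordinates.
\<close>

definition block_points :: "(nat \<Rightarrow> 'x) \<Rightarrow> nat \<Rightarrow> 'p::finite \<Rightarrow> 'x" where
  "block_points x n = (\<lambda>j. x (n + 1 + to_nat_on UNIV j))"

lemma sum_append_block:
  fixes g :: "'x \<Rightarrow> 'a::comm_monoid_add"
  shows "(\<Sum>i=1..n + CARD('p). g (x i)) =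
    (\<Sum>i=1..n. g (x i)) + (\<Sum>j\<in>(UNIV :: 'p::finite set). g (block_points x n j))"
proof -
  have "bij_betw (\<lambda>j. n + 1 + to_nat_on UNIV j) (UNIV :: 'p set) {n + 1..n + CARD('p)}"
  proof -
    have "bij_betw ((+) (n + 1)) {..<CARD('p)} {n + 1..n + CARD('p)}"
      by (rule bij_betw_byWitness[where f' = "\<lambda>i. i - (n + 1)"]) auto
    from bij_betw_trans[OF to_nat_on_finite[OF finite] this] show ?thesis
      by (simp add: o_def)
  qed
  then have "(\<Sum>i=n + 1..n + CARD('p). g (x i)) = (\<Sum>j\<in>(UNIV :: 'p set). g (block_points x n j))"
    unfolding block_points_def by (rule sum.reindex_bij_betw[symmetric])
  moreover have "{1..n + CARD('p)} = {1..n} \<union> {n + 1..n + CARD('p)}" by auto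
  ultimately show ?thesis by (simp add: sum.union_disjoint)
qed

text \<open>
  The information matrix at stage \<open>Suc k\<close> is a weighted mean over the index 0, which stands for
  the \<open>n\<^sub>1\<close> initial points, and the indices 1 to k of the blocks of p points.
\<close>

lemma info_matrix_stages:
  fixes f :: "'t \<Rightarrow> 'x \<Rightarrow> real ^ 'p" and x :: "nat \<Rightarrow> 'x" and \<theta> :: 't
  assumes "n\<^sub>1 \<ge> 1"
  defines "w \<equiv> \<lambda>l :: nat. real (if l = 0 then n\<^sub>1 else CARD('p))"
    and "Y \<equiv> \<lambda>l. if l = 0 then info_matrix f (empirical_design x n\<^sub>1) \<theta>
      else uniform_info f \<theta> (block_points x (sample_size n\<^sub>1 CARD('p) l))"
  shows "info_matrix f (empirical_design x (sample_size n\<^sub>1 CARD('p) (Suc k))) \<theta>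
    = (1 / (\<Sum>l<Suc k. w l)) *\<^sub>R (\<Sum>l<Suc k. w l *\<^sub>R Y l)"
proof -
  have "real (sample_size n\<^sub>1 CARD('p) (Suc k)) = (\<Sum>l<Suc k. w l) \<and>
    (\<Sum>i=1..sample_size n\<^sub>1 CARD('p) (Suc k). outer (f \<theta> (x i))) = (\<Sum>l<Suc k. w l *\<^sub>R Y l)"
  proof (induction k)
    case 0
    then show ?case using assms(1)
      by (simp add: sample_size_def w_def Y_def info_matrix_empirical)
  next
    case (Suc k)
    have size: "sample_size n\<^sub>1 CARD('p) (Suc (Suc k)) = sample_size n\<^sub>1 CARD('p) (Suc k) + CARD('p)"
      by (simp add: sample_size_def)
    have "(\<Sum>j\<in>(UNIV :: 'p set). outer (f \<theta> (block_points x (sample_size n\<^sub>1 CARD('p) (Suc k)) j)))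
      = w (Suc k) *\<^sub>R Y (Suc k)"
      by (simp add: w_def Y_def uniform_info_def)
    moreover have "real CARD('p) = w (Suc k)" by (simp add: w_def)
    ultimately show ?case
      unfolding size sum_append_block[of "\<lambda>y. outer (f \<theta> y)" x]
        sum.lessThan_Suc[of _ "Suc k"] of_nat_add
      using Suc.IH by simp
  qed
  moreover have "sample_size n\<^sub>1 CARD('p) (Suc k) \<ge> 1"
    using assms(1) by (simp add: sample_size_def)
  ultimately show ?thesis by (simp add: info_matrix_empirical)
qed

text \<open>
  The pathwise form of the first assertion, for a single sequence of points and of estimates.
\<close>

lemma infdist_info_matrix_tendsto_0:
  fixes R :: "'x::metric_space set"
    and \<Theta> :: "'t::metric_space set"
    and f :: "'t \<Rightarrow> 'x \<Rightarrow> real ^ 'p"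
  assumes R: "compact R" and cont: "continuous_on (R \<times> \<Theta>) (\<lambda>(x, \<theta>). f \<theta> x)"
    and span: "span (f \<theta>bar ` R) = UNIV" and \<theta>bar: "\<theta>bar \<in> \<Theta>"
    and n1: "n\<^sub>1 \<ge> 1"
    and \<theta>hat: "\<And>k. k \<ge> 1 \<Longrightarrow> \<theta>hat k \<in> \<Theta>" "\<theta>hat \<longlonglongrightarrow> \<theta>bar"
    and step: "\<And>k. k \<ge> 1 \<Longrightarrow> p_step_ahead R f (\<theta>hat k) x (sample_size n\<^sub>1 CARD('p) k)"
  shows "(\<lambda>k. infdist (info_matrix f (empirical_design x (sample_size n\<^sub>1 CARD('p) k)) \<theta>bar)
    (convex hull (D_opt_sat_infos R f \<theta>bar))) \<longlonglongrightarrow> 0"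
proof -
  let ?S = "D_opt_sat_infos R f \<theta>bar"
  have "continuous_on R ((\<lambda>(x, \<theta>). f \<theta> x) \<circ> (\<lambda>x. (x, \<theta>bar)))"
    using \<theta>bar by (intro continuous_on_compose continuous_intros continuous_on_subset[OF cont]) auto
  then have f: "continuous_on R (f \<theta>bar)" by (simp add: o_def)
  have S: "?S = uniform_info f \<theta>bar ` det_maximizers R f \<theta>bar"
    by (rule D_opt_sat_infos_eq[where f = f, OF R f span])
  then have ne: "?S \<noteq> {}"
    using det_maximizers_nonempty[where f = f, OF R f span] by simp
  define w where "w = (\<lambda>l :: nat. real (if l = 0 then n\<^sub>1 else CARD('p)))"
  define Y where "Y = (\<lambda>l. if l = 0 then info_matrix f (empirical_design x n\<^sub>1) \<theta>bar
      else uniform_info f \<theta>bar (block_points x (sample_size n\<^sub>1 CARD('p) l)))"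
  define z :: "nat \<Rightarrow> 'p \<Rightarrow> 'x" where "z k = block_points x (sample_size n\<^sub>1 CARD('p) (Suc k))" for k
  have zmax: "is_arg_max (\<lambda>z. (det (column_matrix f (\<theta>hat (Suc k)) z))\<^sup>2)
      (\<lambda>z. z \<in> {z. range z \<subseteq> R}) (z k)" for k
    using step[of "Suc k"] by (simp add: p_step_ahead_def z_def block_points_def)
  have "(\<lambda>k. infdist (uniform_info f \<theta>bar (z k)) (uniform_info f \<theta>bar `
      {z. is_arg_max (\<lambda>z. (det (column_matrix f \<theta>bar z))\<^sup>2) (\<lambda>z. z \<in> {z. range z \<subseteq> R}) z})) \<longlonglongrightarrow> 0"
    by (rule infdist_argmax_tendsto_0[OF compact_range_subset[OF R]
          continuous_on_det_column_matrix[OF cont] continuous_on_uniform_info[where f = f, OF f]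
          LIMSEQ_Suc[OF \<theta>hat(2)] _ \<theta>bar zmax]) (simp add: \<theta>hat(1))
  then have "(\<lambda>k. infdist (Y (Suc k)) ?S) \<longlonglongrightarrow> 0"
    by (simp add: S det_maximizers_def Y_def z_def)
  \<comment> \<open>The initial design, at index 0, does not matter in the limit.\<close>
  then have YS: "(\<lambda>k. infdist (Y k) ?S) \<longlonglongrightarrow> 0"
    by (rule LIMSEQ_imp_Suc)
  have "\<forall>\<^sub>F k in sequentially. infdist (Y k) (convex hull ?S) \<le> infdist (Y k) ?S"
    using ne by (intro always_eventually allI infdist_mono hull_subset)
  then have Y: "(\<lambda>k. infdist (Y k) (convex hull ?S)) \<longlonglongrightarrow> 0"
    by (rule tendsto_sandwich[OF always_eventually[OF allI[OF infdist_nonneg]] _ tendsto_const YS])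
  have W: "filterlim (\<lambda>k. \<Sum>l<k. w l) at_top sequentially"
  proof (rule filterlim_at_top_mono[OF filterlim_real_sequentially])
    have "real k \<le> (\<Sum>l<k. w l)" for k
    proof -
      have "1 \<le> w l" for l using n1 by (simp add: w_def Suc_le_eq)
      then show ?thesis using sum_mono[of "{..<k}" "\<lambda>_. 1" w] by simp
    qed
    then show "\<forall>\<^sub>F k in sequentially. real k \<le> (\<Sum>l<k. w l)" by simp
  qed
  have stages: "info_matrix f (empirical_design x (sample_size n\<^sub>1 CARD('p) (Suc k))) \<theta>bar
      = (1 / (\<Sum>l<Suc k. w l)) *\<^sub>R (\<Sum>l<Suc k. w l *\<^sub>R Y l)" for k
    unfolding w_def Y_def by (rule info_matrix_stages[OF n1])
  have "(\<lambda>k. infdist ((1 / (\<Sum>l<k. w l)) *\<^sub>R (\<Sum>l<k. w l *\<^sub>R Y l)) (convex hull ?S)) \<longlonglongrightarrow> 0"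
    by (rule infdist_weighted_mean_tendsto_0[OF convex_convex_hull _ _ W Y]) (simp_all add: ne w_def)
  then have "(\<lambda>k. infdist (info_matrix f (empirical_design x (sample_size n\<^sub>1 CARD('p) (Suc k))) \<theta>bar)
      (convex hull ?S)) \<longlonglongrightarrow> 0"
    unfolding stages by (rule LIMSEQ_Suc)
  then show ?thesis by (rule LIMSEQ_imp_Suc)
qed

lemma convex_hull_D_opt_sat_infos_subset:
  fixes f :: "'t::topological_space \<Rightarrow> 'x::metric_space \<Rightarrow> real ^ 'p"
  assumes "compact R" and "continuous_on R (f \<theta>)" and "span (f \<theta> ` R) = UNIV"
  shows "convex hull (D_opt_sat_infos R f \<theta>) \<subseteq> {A. pos_def A \<and> D_opt_sat_value R f \<theta> \<le> det A}"
proof (rule hull_minimal)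
  show "convex {A. pos_def A \<and> D_opt_sat_value R f \<theta> \<le> det A}"
    by (rule convex_pos_def_det_ge)
  show "D_opt_sat_infos R f \<theta> \<subseteq> {A. pos_def A \<and> D_opt_sat_value R f \<theta> \<le> det A}"
  proof
    fix A assume "A \<in> D_opt_sat_infos R f \<theta>"
    then obtain \<eta> where \<eta>: "locally_D_optimal_saturated R f \<theta> \<eta>" and A: "A = info_matrix f \<eta> \<theta>"
      by (auto simp: D_opt_sat_infos_def)
    obtain z0 where z0: "z0 \<in> det_maximizers R f \<theta>"
      using det_maximizers_nonempty[where f = f, OF assms] by blast
    have sat: "saturated_design CARD('p) R \<eta>" and det: "det A = det (uniform_info f \<theta> z0)"
      using saturated_optimum(2)[where f = f, OF assms z0] \<eta> A by auto
    have "det A \<noteq> 0"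
      using saturated_optimum(1)[where f = f, OF assms z0] det by simp
    then have "pos_def A"
      unfolding A using sat by (intro pos_def_info_matrix) (auto simp: saturated_design_def design_def)
    then show "A \<in> {A. pos_def A \<and> D_opt_sat_value R f \<theta> \<le> det A}"
      using D_opt_sat_value_eq[where f = f, OF \<eta>] A by simp
  qed
qed

theorem corollary4p1:
  fixes R :: "'x::metric_space set"
    and \<Theta> :: "'t::metric_space set"
    and f :: "'t \<Rightarrow> 'x \<Rightarrow> real ^ 'p"
    and P :: "'w measure"
    and X :: "nat \<Rightarrow> 'w \<Rightarrow> 'x"
    and \<theta>hat :: "nat \<Rightarrow> 'w \<Rightarrow> 't"
    and \<theta>bar :: 't
    and n\<^sub>1 :: nat
    and \<xi> :: "nat \<Rightarrow> 'w \<Rightarrow> 'x pmf"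
  assumes "compact R"
    and "compact \<Theta>"
    and "continuous_on (R \<times> \<Theta>) (\<lambda>(x, \<theta>). f \<theta> x)"
    and "\<And>\<theta>. \<theta> \<in> \<Theta> \<Longrightarrow> span (f \<theta> ` R) = UNIV"
    and "prob_space P"
    and "\<And>i. i \<ge> 1 \<Longrightarrow> X i \<in> P \<rightarrow>\<^sub>M restrict_space borel R"
    and "\<And>k. k \<ge> 1 \<Longrightarrow> \<theta>hat k \<in> P \<rightarrow>\<^sub>M restrict_space borel \<Theta>"
    and "n\<^sub>1 \<ge> 1"
    and "\<And>\<omega> k. \<omega> \<in> space P \<Longrightarrow> k \<ge> 1 \<Longrightarrow>
           p_step_ahead R f (\<theta>hat k \<omega>) (\<lambda>i. X i \<omega>) (sample_size n\<^sub>1 CARD('p) k)"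
    and "\<And>k \<omega>. \<xi> k \<omega> = empirical_design (\<lambda>i. X i \<omega>) (sample_size n\<^sub>1 CARD('p) k)"
    and "\<theta>bar \<in> \<Theta>"
    and "AE \<omega> in P. (\<lambda>k. \<theta>hat k \<omega>) \<longlonglongrightarrow> \<theta>bar"
  shows
    "((AE \<omega> in P. (\<lambda>k. infdist (info_matrix f (\<xi> k \<omega>) \<theta>bar)
                          (convex hull (D_opt_sat_infos R f \<theta>bar))) \<longlonglongrightarrow> 0) \<and>
      (AE \<omega> in P. liminf (\<lambda>k. ereal (det (info_matrix f (\<xi> k \<omega>) \<theta>bar)))
                     \<ge> ereal (D_opt_sat_value R f \<theta>bar))) \<and>
     (\<forall>M\<^sub>s.
        (\<forall>\<eta>. locally_D_optimal_saturated R f \<theta>bar \<eta> \<longrightarrow> info_matrix f \<eta> \<theta>bar = M\<^sub>s) \<longrightarrow>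
        (AE \<omega> in P. (\<lambda>k. info_matrix f (\<xi> k \<omega>) \<theta>bar) \<longlonglongrightarrow> M\<^sub>s) \<and>
        (AE \<omega> in P. (\<lambda>k. det (info_matrix f (\<xi> k \<omega>) \<theta>bar))
                      \<longlonglongrightarrow> D_opt_sat_value R f \<theta>bar)) \<and>
     ((\<exists>\<eta>. locally_D_optimal R f \<theta>bar \<eta> \<and> saturated_design CARD('p) R \<eta>) \<longrightarrow>
        (AE \<omega> in P. (\<lambda>k. info_matrix f (\<xi> k \<omega>) \<theta>bar) \<longlonglongrightarrow> D_opt_info R f \<theta>bar) \<and>
        (AE \<omega> in P. (\<lambda>k. det (info_matrix f (\<xi> k \<omega>) \<theta>bar))
                      \<longlonglongrightarrow> D_opt_value R f \<theta>bar))"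
proof -
  note R = assms(1) and cont = assms(3) and span = assms(4)[OF assms(11)]
  let ?S = "D_opt_sat_infos R f \<theta>bar"
  let ?M = "\<lambda>k \<omega>. info_matrix f (\<xi> k \<omega>) \<theta>bar"
  have "continuous_on R ((\<lambda>(x, \<theta>). f \<theta> x) \<circ> (\<lambda>x. (x, \<theta>bar)))"
    using assms(11) by (intro continuous_on_compose continuous_intros continuous_on_subset[OF cont]) auto
  then have f: "continuous_on R (f \<theta>bar)" by (simp add: o_def)
  note reg = R f span
  obtain z0 where z0: "z0 \<in> det_maximizers R f \<theta>bar"
    using det_maximizers_nonempty[where f = f, OF reg] by blast
  have "uniform_info f \<theta>bar z0 \<in> ?S"
    by (rule saturated_optimum(3)[where f = f, OF reg z0])
  then obtain \<eta>0 where \<eta>0: "locally_D_optimal_saturated R f \<theta>bar \<eta>0"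
    by (auto simp: D_opt_sat_infos_def)
  then have ne: "?S \<noteq> {}" by (auto simp: D_opt_sat_infos_def)
  \<comment> \<open>All assertions follow, path by path, from the convergence of the distance to the hull.\<close>
  have AE: "AE \<omega> in P. Q \<omega>"
    if Q: "\<And>\<omega>. (\<lambda>k. infdist (?M k \<omega>) (convex hull ?S)) \<longlonglongrightarrow> 0 \<Longrightarrow> Q \<omega>" for Q
    using assms(12) AE_space
  proof eventually_elim
    case (elim \<omega>)
    have "\<theta>hat k \<omega> \<in> \<Theta>" if "k \<ge> 1" for k
      using measurable_space[OF assms(7)[OF that] elim(2)] by (simp add: space_restrict_space)
    then have "(\<lambda>k. infdist (?M k \<omega>) (convex hull ?S)) \<longlonglongrightarrow> 0"
      unfolding assms(10)
      by (rule infdist_info_matrix_tendsto_0[OF R cont span assms(11,8) _ elim(1) assms(9)[OF elim(2)]])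
    then show ?case by (rule Q)
  qed
  have part1: "AE \<omega> in P. (\<lambda>k. infdist (?M k \<omega>) (convex hull ?S)) \<longlonglongrightarrow> 0"
    by (rule AE)
  have "liminf (\<lambda>k. ereal (det (?M k \<omega>))) \<ge> ereal (D_opt_sat_value R f \<theta>bar)"
    if "(\<lambda>k. infdist (?M k \<omega>) (convex hull ?S)) \<longlonglongrightarrow> 0" for \<omega>
  proof (rule liminf_ge_of_infdist_tendsto_0[OF _ _ _ _ that])
    show "compact (convex hull ?S)"
      by (intro compact_convex_hull compact_D_opt_sat_infos[where f = f, OF reg])
    show "convex hull ?S \<noteq> {}" using ne by simp
    show "continuous_on UNIV (det :: real ^ 'p ^ 'p \<Rightarrow> real)"
      by (intro continuous_on_det continuous_on_id)
    show "D_opt_sat_value R f \<theta>bar \<le> det A" if "A \<in> convex hull ?S" for A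
      using convex_hull_D_opt_sat_infos_subset[where f = f, OF reg] that by blast
  qed
  then have part2: "AE \<omega> in P. liminf (\<lambda>k. ereal (det (?M k \<omega>))) \<ge> ereal (D_opt_sat_value R f \<theta>bar)"
    by (rule AE)
  have part3: "(AE \<omega> in P. (\<lambda>k. ?M k \<omega>) \<longlonglongrightarrow> M\<^sub>s) \<and>
      (AE \<omega> in P. (\<lambda>k. det (?M k \<omega>)) \<longlonglongrightarrow> D_opt_sat_value R f \<theta>bar)"
    if unique: "\<forall>\<eta>. locally_D_optimal_saturated R f \<theta>bar \<eta> \<longrightarrow> info_matrix f \<eta> \<theta>bar = M\<^sub>s" for M\<^sub>s
  proof -
    have S: "?S = {M\<^sub>s}" using unique \<eta>0 by (auto simp: D_opt_sat_infos_def)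
    have val: "D_opt_sat_value R f \<theta>bar = det M\<^sub>s"
      using D_opt_sat_value_eq[where f = f, OF \<eta>0] unique \<eta>0 by simp
    have lim: "(\<lambda>k. ?M k \<omega>) \<longlonglongrightarrow> M\<^sub>s"
      if "(\<lambda>k. infdist (?M k \<omega>) (convex hull ?S)) \<longlonglongrightarrow> 0" for \<omega>
      using that unfolding S by (subst tendsto_dist_iff) simp
    have det_lim: "(\<lambda>k. det (?M k \<omega>)) \<longlonglongrightarrow> D_opt_sat_value R f \<theta>bar"
      if "(\<lambda>k. infdist (?M k \<omega>) (convex hull ?S)) \<longlonglongrightarrow> 0" for \<omega>
      unfolding val
      using continuous_on_tendsto_compose[OF continuous_on_det[OF continuous_on_id] lim[OF that], of UNIV]
      by simp
    show ?thesis using AE[OF lim] AE[OF det_lim] by (rule conjI)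
  qed
  have part4: "(AE \<omega> in P. (\<lambda>k. ?M k \<omega>) \<longlonglongrightarrow> D_opt_info R f \<theta>bar) \<and>
      (AE \<omega> in P. (\<lambda>k. det (?M k \<omega>)) \<longlonglongrightarrow> D_opt_value R f \<theta>bar)"
    if opt: "locally_D_optimal R f \<theta>bar \<eta>" and sat: "saturated_design CARD('p) R \<eta>" for \<eta>
  proof -
    have sat_opt: "locally_D_optimal_saturated R f \<theta>bar \<eta>"
      using opt sat by (auto simp: locally_D_optimal_def locally_D_optimal_saturated_def
          is_arg_max_linorder saturated_design_def)
    have nz: "det (info_matrix f \<eta> \<theta>bar) \<noteq> 0"
      using saturated_optimum(1,2)[where f = f, OF reg z0] sat_opt by auto
    have unique: "info_matrix f \<zeta> \<theta>bar = info_matrix f \<eta> \<theta>bar" if "locally_D_optimal R f \<theta>bar \<zeta>" for \<zeta>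
      using D_optimal_info_unique[where f = f, OF opt that nz] by simp
    have info: "D_opt_info R f \<theta>bar = info_matrix f \<eta> \<theta>bar"
      unfolding D_opt_info_def
    proof (rule the_equality)
      show "\<exists>\<zeta>. locally_D_optimal R f \<theta>bar \<zeta> \<and> info_matrix f \<eta> \<theta>bar = info_matrix f \<zeta> \<theta>bar"
        using opt by (intro exI[of _ \<eta>] conjI refl)
      show "A = info_matrix f \<eta> \<theta>bar"
        if "\<exists>\<zeta>. locally_D_optimal R f \<theta>bar \<zeta> \<and> A = info_matrix f \<zeta> \<theta>bar" for A
        using that by (elim exE conjE) (simp only: unique)
    qed
    have val: "D_opt_value R f \<theta>bar = D_opt_sat_value R f \<theta>bar"
      using D_opt_value_eq[where f = f, OF opt] D_opt_sat_value_eq[where f = f, OF sat_opt] by simp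
    have "info_matrix f \<zeta> \<theta>bar = info_matrix f \<eta> \<theta>bar"
      if \<zeta>: "locally_D_optimal_saturated R f \<theta>bar \<zeta>" for \<zeta>
    proof (rule unique)
      have "det (info_matrix f \<zeta> \<theta>bar) = det (info_matrix f \<eta> \<theta>bar)"
        using D_opt_sat_value_eq[where f = f, OF \<zeta>] D_opt_sat_value_eq[where f = f, OF sat_opt] by simp
      then show "locally_D_optimal R f \<theta>bar \<zeta>"
        using opt \<zeta> by (simp add: locally_D_optimal_def locally_D_optimal_saturated_def
            is_arg_max_linorder saturated_design_def)
    qed
    then show ?thesis unfolding info val by (intro part3 allI impI)
  qed
  show ?thesis
    by (intro conjI[OF conjI[OF part1 part2]] conjI allI impI; (elim exE conjE)?)
      (simp_all only: part3 part4)
qed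

end
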